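(* Let $(X,\mathfrak{M},\mu)$ be a measure space with a doubling and regular ball-basis $\mathscr{B}$, let $\omega:[1,\infty)\to[0,1]$ be a modulus of continuity satisfying $$I(\omega)=1+\int_1^\infty\omega(t)\log(1+t)\,dt<\infty,$$ and let $\mathscr{G}=\{\{\phi_B\}_{B\in\mathscr{B}},\{\mathscr{B}(x)\}_{x\in X}\}$ be a KB-couple whose kernel-structure satisfies (K2) with this $\omega$. There is a constant $C>0$, depending only on $\mathscr{B}$ and $\mathscr{G}$, such that: if $f\in\mathrm{BMO}(X)$ and $\mathcal{M}f$ is not identically infinite, then $\mathcal{M}_{\mathscr{G}}f\in\mathrm{BLO}(X)$ and $$\|\mathcal{M}_{\mathscr{G}}f\|_{\mathrm{BLO}(X)}\le C\,I(\omega)\,\|f\|_{\mathrm{BMO}(X)}.$$ Moreover, if $\mu(X)<\infty$, then $\mathcal{M}_{\mathscr{G}}$ maps $\mathrm{BMO}(X)$ boundedly into $\mathrm{BLO}(X)$ (that is, for every $f\in\mathrm{BMO}(X)$, without assuming that $\mathcal{M}f$ is not identically infinite, one has $\mathcal{M}_{\mathscr{G}}f\in\mathrm{BLO}(X)$ and $\|\mathcal{M}_{\mathscr{G}}f\|_{\mathrm{BLO}(X)}\le C\,I(\omega)\,\|f\|_{\mathrm{BMO}(X)}$).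
   Context: **Ball-basis.** Let $(X,\mathfrak{M},\mu)$ be a measure space. A family $\mathscr{B}\subset\mathfrak{M}$ (its elements are called balls) is a ball-basis if: (B1) $0<\mu(B)<\infty$ for all $B\in\mathscr{B}$; (B2) for any $x,y\in X$ there is a ball containing both; (B3) for every $E\in\mathfrak{M}$ and $\varepsilon>0$ there is a finite or infinite sequence of balls $B_k$ with $\mu(E\bigtriangleup\bigcup_kB_k)<\varepsilon$; (B4) for each $B\in\mathscr{B}$ there is a ball $B^*\in\mathscr{B}$ (a hull-ball of $B$, fixed once and for all) such that $\bigcup\{A\in\mathscr{B}:\mu(A)\le2\mu(B),\,A\cap B\ne\varnothing\}\subset B^*$ and $\mu(B^* )\le\mathcal{K}\mu(B)$, with $\mathcal{K}>0$ independent of $B$. It is doubling if there is a constant $\eta>2$ such that for every ball $B$ with $B^*\ne X$ there is a ball $B'\supset B$ with $2\mu(B)\le\mu(B')\le\eta\mu(B)$. It is regular if there is a constant $0<\theta<1$ such that $\mu(B^*\cap A)\ge\theta\mu(B^* )$ for any balls $A,B$ with $\mu(B)\le\mu(A)$, $A\cap B\ne\varnothing$. **Modulus of continuity.** A non-increasing $\omega:[1,\infty)\to[0,1]$ with $\omega(1)=1$ and $\omega(2x)\le c_0\,\omega(x)$ for a constant $c_0>0$. $\log=\log_2$. **Kernel-structure.** Put $d(x,B)=\inf\{\mu(A):A\in\mathscr{B},\,A\supset B\cup\{x\}\}$. A family of nonnegative functions $\{\phi_B:B\in\mathscr{B}\}\subset L^1(X)\cap L^\infty(X)$ is a kernel-structure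 if there are positive constants $c_0,c_1,c_2$ such that for every ball $B$: (K1) $\int_X\phi_B\,d\mu=1$; (K2) $c_1\frac{\mathbf{1}_B(x)}{\mu(B)}\le\phi_B(x)\le \frac{c_2}{\mu(B)}\,\omega\!\left(\frac{d(x,B)}{\mu(B)}\right)$ for $x\in X$, where $\omega$ is a modulus of continuity (with constant $c_0$). **Basis-structure.** Families $\mathscr{B}(x)\subset\mathscr{B}$, $x\in X$, such that (G1) $x\in B$ for every $B\in\mathscr{B}(x)$; (G2) for every ball $B\ni x$ there is $\bar B\in\mathscr{B}(x)$ with $\bar B\supset B$ and $\mu(\bar B)\le\eta'\mu(B)$, where $\eta'\ge1$ is a constant. **KB-couple.** A pair $\mathscr{G}$ consisting of a kernel-structure and a basis-structure. Its maximal operator is $\mathcal{M}_{\mathscr{G}}f(x)=\sup_{B\in\mathscr{B}(x)}\int_X|f|\phi_B\,d\mu$. The standard maximal function is $\mathcal{M}f(x)=\sup_{B\in\mathscr{B},\,B\ni x}\frac1{\mu(B)}\int_B|f|\,d\mu$. **Spaces.** $\mathrm{BMO}(X)$: a.e. finite measurable $f$ with $\|f\|_{\mathrm{BMO}}=\sup_{B\in\mathscr{B}}\frac1{\mu(B)}\int_B|f-f_B|<\infty$, where $f_B=\frac1{\mu(B)}\int_Bf$. $\mathrm{BLO}(X)$: a.e. finite $h$ with $\|h\|_{\mathrm{BLO}}=\sup_{B\in\mathscr{B}}\frac1{\mu(B)}\int_B(h-\operatorname{ess\,inf}_Bh)<\infty$. Since $\mathcal{M}_{\mathscr{G}}f$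 may be non-measurable, the integral over a ball $B$ of a nonnegative, possibly non-measurable function $u$ is understood as $\int_0^\infty\mu^*\{x\in B:u(x)>t\}\,dt$, where $\mu^*(E)=\inf\{\mu(F):F\in\mathfrak{M},F\supset E\}$; essential bounds are taken up to subsets of $\mu$-null sets. *)

theory Defs
  imports "HOL-Analysis.Analysis"
begin

text \<open>
  Throughout, the measure space $X$ is \<^term>\<open>space M\<close> with $\sigma$-algebra \<^term>\<open>sets M\<close>.
  All structural constants are explicit parameters, so that a bound can be stated to depend on
  these constants only.
\<close>

locale ball_basis =
  fixes M :: "'a measure" and \<B> :: "'a set set" and hullb :: "'a set \<Rightarrow> 'a set" and K :: real
  assumes balls_sets: "\<B> \<subseteq> sets M"
    and K_pos: "K > 0"
    and B1: "B \<in> \<B> \<Longrightarrow> 0 < emeasure M B \<and> emeasure M B < \<infinity>"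
    and B2: "x \<in> space M \<Longrightarrow> y \<in> space M \<Longrightarrow> \<exists>B\<in>\<B>. x \<in> B \<and> y \<in> B"
    \<comment> \<open>the countable family \<open>\<C>\<close> is the set of members of a finite (possibly empty) or infinite
        sequence of balls\<close>
    and B3: "E \<in> sets M \<Longrightarrow> \<epsilon> > (0::real) \<Longrightarrow>
      \<exists>\<C>. countable \<C> \<and> \<C> \<subseteq> \<B> \<and> emeasure M (sym_diff E (\<Union>\<C>)) < ennreal \<epsilon>"
    and hull_ball: "B \<in> \<B> \<Longrightarrow> hullb B \<in> \<B>"
    and hull_superset:
      "B \<in> \<B> \<Longrightarrow> \<Union>{A \<in> \<B>. measure M A \<le> 2 * measure M B \<and> A \<inter> B \<noteq> {}} \<subseteq> hullb B"
    and hull_measure: "B \<in> \<B> \<Longrightarrow> measure M (hullb B) \<le> K * measure M B"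

definition doubling_basis ::
    "'a measure \<Rightarrow> 'a set set \<Rightarrow> ('a set \<Rightarrow> 'a set) \<Rightarrow> real \<Rightarrow> bool" where
  "doubling_basis M \<B> hullb \<eta> \<longleftrightarrow> \<eta> > 2 \<and>
     (\<forall>B\<in>\<B>. hullb B \<noteq> space M \<longrightarrow>
        (\<exists>B'\<in>\<B>. B \<subseteq> B' \<and> 2 * measure M B \<le> measure M B' \<and> measure M B' \<le> \<eta> * measure M B))"

definition regular_basis ::
    "'a measure \<Rightarrow> 'a set set \<Rightarrow> ('a set \<Rightarrow> 'a set) \<Rightarrow> real \<Rightarrow> bool" where
  "regular_basis M \<B> hullb \<theta> \<longleftrightarrow> 0 < \<theta> \<and> \<theta> < 1 \<and>
     (\<forall>A\<in>\<B>. \<forall>B\<in>\<B>. measure M B \<le> measure M A \<and> A \<inter> B \<noteq> {} \<longrightarrow>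
        measure M (hullb B \<inter> A) \<ge> \<theta> * measure M (hullb B))"

definition modulus_of_continuity :: "(real \<Rightarrow> real) \<Rightarrow> real \<Rightarrow> bool" where
  "modulus_of_continuity \<omega> c\<^sub>0 \<longleftrightarrow>
     antimono_on {1..} \<omega> \<and> (\<forall>x\<ge>1. 0 \<le> \<omega> x \<and> \<omega> x \<le> 1) \<and> \<omega> 1 = 1 \<and>
     c\<^sub>0 > 0 \<and> (\<forall>x\<ge>1. \<omega> (2 * x) \<le> c\<^sub>0 * \<omega> x)"

definition modulus_integral :: "(real \<Rightarrow> real) \<Rightarrow> ennreal" where
  "modulus_integral \<omega> = 1 + (\<integral>\<^sup>+t\<in>{1..}. ennreal (\<omega> t * log 2 (1 + t)) \<partial>lborel)"

text \<open>In a ball-basis the infimum below is over a nonempty set, by \<open>B2\<close> and the hull property.\<close>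

definition ball_dist :: "'a measure \<Rightarrow> 'a set set \<Rightarrow> 'a \<Rightarrow> 'a set \<Rightarrow> real" where
  "ball_dist M \<B> x B = (INF A\<in>{A \<in> \<B>. B \<union> {x} \<subseteq> A}. measure M A)"

definition kernel_structure ::
    "'a measure \<Rightarrow> 'a set set \<Rightarrow> (real \<Rightarrow> real) \<Rightarrow> real \<Rightarrow> real \<Rightarrow> real \<Rightarrow>
     ('a set \<Rightarrow> 'a \<Rightarrow> real) \<Rightarrow> bool" where
  "kernel_structure M \<B> \<omega> c\<^sub>0 c\<^sub>1 c\<^sub>2 \<phi> \<longleftrightarrow>
     modulus_of_continuity \<omega> c\<^sub>0 \<and> c\<^sub>1 > 0 \<and> c\<^sub>2 > 0 \<and>
     (\<forall>B\<in>\<B>.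
        (\<forall>x\<in>space M. \<phi> B x \<ge> 0) \<and>
        integrable M (\<phi> B) \<and> (\<exists>b. AE x in M. \<bar>\<phi> B x\<bar> \<le> b) \<and>
        (\<integral>x. \<phi> B x \<partial>M) = 1 \<and>
        (\<forall>x\<in>space M. c\<^sub>1 * (indicator B x / measure M B) \<le> \<phi> B x \<and>
           \<phi> B x \<le> c\<^sub>2 / measure M B * \<omega> (ball_dist M \<B> x B / measure M B)))"

definition basis_structure ::
    "'a measure \<Rightarrow> 'a set set \<Rightarrow> real \<Rightarrow> ('a \<Rightarrow> 'a set set) \<Rightarrow> bool" where
  "basis_structure M \<B> \<eta>' G \<longleftrightarrow> \<eta>' \<ge> 1 \<and>
     (\<forall>x\<in>space M. G x \<subseteq> \<B> \<and> (\<forall>B\<in>G x. x \<in> B) \<and>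
        (\<forall>B\<in>\<B>. x \<in> B \<longrightarrow> (\<exists>B'\<in>G x. B \<subseteq> B' \<and> measure M B' \<le> \<eta>' * measure M B)))"

definition KB_couple ::
    "'a measure \<Rightarrow> 'a set set \<Rightarrow> (real \<Rightarrow> real) \<Rightarrow> real \<Rightarrow> real \<Rightarrow> real \<Rightarrow> real \<Rightarrow>
     ('a set \<Rightarrow> 'a \<Rightarrow> real) \<times> ('a \<Rightarrow> 'a set set) \<Rightarrow> bool" where
  "KB_couple M \<B> \<omega> c\<^sub>0 c\<^sub>1 c\<^sub>2 \<eta>' \<G> \<longleftrightarrow>
     kernel_structure M \<B> \<omega> c\<^sub>0 c\<^sub>1 c\<^sub>2 (fst \<G>) \<and> basis_structure M \<B> \<eta>' (snd \<G>)"

definition KB_maximal ::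
    "'a measure \<Rightarrow> ('a set \<Rightarrow> 'a \<Rightarrow> real) \<times> ('a \<Rightarrow> 'a set set) \<Rightarrow> ('a \<Rightarrow> ereal) \<Rightarrow> 'a \<Rightarrow> ennreal" where
  "KB_maximal M \<G> f x =
     (SUP B\<in>snd \<G> x. \<integral>\<^sup>+y. e2ennreal \<bar>f y\<bar> * ennreal (fst \<G> B y) \<partial>M)"

definition std_maximal :: "'a measure \<Rightarrow> 'a set set \<Rightarrow> ('a \<Rightarrow> ereal) \<Rightarrow> 'a \<Rightarrow> ennreal" where
  "std_maximal M \<B> f x =
     (SUP B\<in>{B \<in> \<B>. x \<in> B}. (\<integral>\<^sup>+y\<in>B. e2ennreal \<bar>f y\<bar> \<partial>M) / emeasure M B)"

text \<open>
  Functions in BMO may be infinite on a null set; \<^const>\<open>real_of_ereal\<close> replaces the infinite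
  values by 0, which does not affect the average.
\<close>

definition ball_avg :: "'a measure \<Rightarrow> 'a set \<Rightarrow> ('a \<Rightarrow> ereal) \<Rightarrow> real" where
  "ball_avg M B f = (LINT x:B|M. real_of_ereal (f x)) / measure M B"

definition bmo_norm :: "'a measure \<Rightarrow> 'a set set \<Rightarrow> ('a \<Rightarrow> ereal) \<Rightarrow> ennreal" where
  "bmo_norm M \<B> f =
     (SUP B\<in>\<B>. (\<integral>\<^sup>+x\<in>B. e2ennreal \<bar>f x - ereal (ball_avg M B f)\<bar> \<partial>M) / emeasure M B)"

text \<open>Integrability on balls is what makes the averages \<^const>\<open>ball_avg\<close> meaningful.\<close>

definition BMO :: "'a measure \<Rightarrow> 'a set set \<Rightarrow> ('a \<Rightarrow> ereal) set" where
  "BMO M \<B> = {f \<in> borel_measurable M.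
     (AE x in M. \<bar>f x\<bar> \<noteq> \<infinity>) \<and>
     (\<forall>B\<in>\<B>. set_integrable M B (\<lambda>x. real_of_ereal (f x))) \<and>
     bmo_norm M \<B> f < \<infinity>}"

text \<open>
  The following notions apply to functions that need not be measurable. Note that
  \<open>AE x in M. P x\<close> only asks the exceptional set to be contained in a null set.
\<close>

definition ess_inf_on :: "'a measure \<Rightarrow> 'a set \<Rightarrow> ('a \<Rightarrow> ereal) \<Rightarrow> ereal" where
  "ess_inf_on M B h = Sup {c. AE x in M. x \<in> B \<longrightarrow> c \<le> h x}"

definition outer_integral_on :: "'a measure \<Rightarrow> 'a set \<Rightarrow> ('a \<Rightarrow> ennreal) \<Rightarrow> ennreal" where
  "outer_integral_on M B u =
     (\<integral>\<^sup>+t\<in>{0<..}. outer_measure_of M {x \<in> B. u x > ennreal t} \<partial>lborel)"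

text \<open>
  The difference \<open>h - ess inf\<^sub>B h\<close> is nonnegative almost everywhere on \<open>B\<close>; \<^const>\<open>e2ennreal\<close> sends
  its negative values on the exceptional null set to 0.
\<close>

definition blo_norm :: "'a measure \<Rightarrow> 'a set set \<Rightarrow> ('a \<Rightarrow> ereal) \<Rightarrow> ennreal" where
  "blo_norm M \<B> h =
     (SUP B\<in>\<B>. outer_integral_on M B (\<lambda>x. e2ennreal (h x - ess_inf_on M B h)) / emeasure M B)"

definition BLO :: "'a measure \<Rightarrow> 'a set set \<Rightarrow> ('a \<Rightarrow> ereal) set" where
  "BLO M \<B> = {h. (AE x in M. \<bar>h x\<bar> \<noteq> \<infinity>) \<and> blo_norm M \<B> h < \<infinity>}"

end

theory Submission
  imports Defs
begin

text \<open>
  After replacing \<open>f\<close> by \<open>g = \<bar>f\<bar>\<close>, whose mean oscillation is at most twice that of \<open>f\<close>, the theorem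
  rests on three facts about a nonnegative function \<open>g\<close> of mean oscillation at most \<open>s\<close>. Write \<open>g\<^sub>A\<close>
  for the mean of \<open>g\<close> over the ball \<open>A\<close>.

  \<^item> Averages against the kernel of \<open>A\<close> differ from \<open>g\<^sub>A\<close> by at most a constant times
    \<open>modulus_integral \<omega> * s\<close> (\<open>kernel_deviation\<close>). The dilate of \<open>A\<close> of measure about \<open>2^k * \<mu>(A)\<close> is
    reached by at most \<open>k\<close> doublings, each of which changes the mean by \<open>O(s)\<close>; weighting
    \<open>O(k * s)\<close> with the size of the kernel on the \<open>k\<close>-th layer and summing gives the integral of
    \<open>\<omega> t * log 2 (1 + t)\<close>.

  \<^item> For a ball \<open>B\<close>, the points of \<open>B\<close> lying in a ball \<open>A\<close> not larger than \<open>B\<close> with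
    \<open>\<bar>g\<^sub>A - g\<^sub>B\<bar> > t\<close> form a set of outer measure \<open>O(2^(-t/(L*s)) * \<mu>(B))\<close>, where \<open>L\<close> is a
    structural constant (\<open>deviation_decay\<close>, a John--Nirenberg inequality for means over balls). Stopping balls at a fixed height, selected
    disjointly by Vitali's method, have dilates of total measure at most \<open>\<mu>(B)/2\<close>, and outside these
    dilates the deviation is bounded; inside, one repeats the argument.

  \<^item> If \<open>x\<close> and \<open>y\<close> lie in \<open>B\<close> and \<open>x\<close> is outside the deviation set of height \<open>t\<close>, the maximal
    function at \<open>x\<close> exceeds the one at \<open>y\<close> by at most \<open>O(modulus_integral \<omega> * s) + t\<close>
    (\<open>kernel_max_comparison\<close>). Balls larger than \<open>B\<close> that meet it at \<open>x\<close> are seen, after passing to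
    their hulls, from \<open>y\<close> as well; smaller ones are controlled by \<open>g\<^sub>B\<close> and \<open>t\<close>.

  Taking the infimum over \<open>y\<close> bounds the maximal function at \<open>x\<close> minus its essential infimum on \<open>B\<close>,
  and the exponential decay makes the outer integral of the remaining \<open>t\<close> converge. Almost everywhere
  finiteness follows from the same comparison with one point where the standard maximal function is
  finite, through a countable cover by balls containing this point. On a space of finite measure,
  which is itself a ball, such a point is any point outside a deviation set of the whole space.
\<close>

section \<open>Geometry of ball-bases\<close>

context ball_basis
begin

lemma ball_sets [measurable]: "B \<in> \<B> \<Longrightarrow> B \<in> sets M"
  using balls_sets by auto

lemma ball_emeasure: "B \<in> \<B> \<Longrightarrow> emeasure M B = ennreal (measure M B)"
  using B1[of B] by (simp add: emeasure_eq_ennreal_measure less_top)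

lemma ball_pos: "B \<in> \<B> \<Longrightarrow> 0 < measure M B"
  using B1[of B] by (simp add: ball_emeasure)

lemma ball_nonempty: "B \<in> \<B> \<Longrightarrow> B \<noteq> {}"
  using ball_pos[of B] by auto

lemma ball_fmeasurable [simp, intro]: "B \<in> \<B> \<Longrightarrow> B \<in> fmeasurable M"
  using B1[of B] by (intro fmeasurableI) auto

lemma ball_in_space: "B \<in> \<B> \<Longrightarrow> x \<in> B \<Longrightarrow> x \<in> space M"
  using sets.sets_into_space[OF ball_sets] by blast

lemma ball_mono: "A \<in> \<B> \<Longrightarrow> B \<in> \<B> \<Longrightarrow> A \<subseteq> B \<Longrightarrow> measure M A \<le> measure M B"
  by (intro measure_mono_fmeasurable) auto

lemma meeting_ball_subset_hull:
  assumes "A \<in> \<B>" "B \<in> \<B>" "measure M A \<le> 2 * measure M B" "x \<in> A" "x \<in> B"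
  shows "A \<subseteq> hullb B"
  using hull_superset[OF assms(2)] assms by blast

lemma ball_subset_hull: "B \<in> \<B> \<Longrightarrow> B \<subseteq> hullb B"
  using meeting_ball_subset_hull[of B B] ball_nonempty[of B] ball_pos[of B] by auto

lemma K_ge_1: assumes "B \<in> \<B>" shows "1 \<le> K"
proof -
  have "1 * measure M B \<le> K * measure M B"
    using ball_mono[OF assms hull_ball[OF assms] ball_subset_hull[OF assms]] hull_measure[OF assms]
    by simp
  then show ?thesis using ball_pos[OF assms] by simp
qed

text \<open>
  Vitali's selection. Among the disjoint subfamilies that dominate, up to a factor 2 in measure,
  every member of the family that they meet, take a maximal one. If it missed some members, one of
  them would have more than half of the supremum of the measures of the missed members, and
  adjoining it would contradict maximality. Countability holds because a finite-measure ball
  contains the union and balls have positive measure.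
\<close>

lemma vitali_selection:
  assumes sub: "\<A> \<subseteq> \<B>" and inS: "\<And>A. A \<in> \<A> \<Longrightarrow> A \<subseteq> S" and S: "S \<in> \<B>"
  obtains \<D> where "\<D> \<subseteq> \<A>" "pairwise disjnt \<D>" "countable \<D>"
    "\<And>A. A \<in> \<A> \<Longrightarrow> \<exists>D\<in>\<D>. A \<inter> D \<noteq> {} \<and> measure M A \<le> 2 * measure M D"
proof -
  \<comment> \<open>\<open>dom \<D> A\<close>: some member of \<open>\<D>\<close> meets \<open>A\<close> and has at least half its measure\<close>
  define dom where "dom \<D> A \<longleftrightarrow> (\<exists>D\<in>\<D>. A \<inter> D \<noteq> {} \<and> measure M A \<le> 2 * measure M D)" for \<D> A
  define \<Z> where "\<Z> = {\<D>. \<D> \<subseteq> \<A> \<and> pairwise disjnt \<D> \<and> (\<forall>A\<in>\<A>. A \<inter> \<Union>\<D> \<noteq> {} \<longrightarrow> dom \<D> A)}"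
  have "\<exists>\<D>\<in>\<Z>. \<forall>\<E>\<in>\<Z>. \<D> \<subseteq> \<E> \<longrightarrow> \<E> = \<D>"
  proof (rule subset_Zorn')
    fix \<C> assume C: "subset.chain \<Z> \<C>"
    then have CZ: "\<C> \<subseteq> \<Z>" by (auto simp: subset.chain_def)
    have "pairwise disjnt (\<Union>\<C>)"
      by (rule pairwise_chain_Union) (use C CZ in \<open>auto simp: \<Z>_def subset_chain_def chain_subset_def\<close>)
    moreover have "dom (\<Union>\<C>) A" if "A \<in> \<A>" "A \<inter> \<Union>(\<Union>\<C>) \<noteq> {}" for A
    proof -
      from that obtain \<D> where D: "\<D> \<in> \<C>" "A \<inter> \<Union>\<D> \<noteq> {}" by blast
      then have "dom \<D> A" using CZ that(1) by (auto simp: \<Z>_def)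
      then show ?thesis using D(1) unfolding dom_def by blast
    qed
    moreover have "\<Union>\<C> \<subseteq> \<A>" using CZ by (auto simp: \<Z>_def)
    ultimately show "\<Union>\<C> \<in> \<Z>" by (auto simp: \<Z>_def)
  qed
  then obtain \<D> where DZ: "\<D> \<in> \<Z>" and max: "\<And>\<E>. \<E> \<in> \<Z> \<Longrightarrow> \<D> \<subseteq> \<E> \<Longrightarrow> \<E> = \<D>" by blast
  have DA: "\<D> \<subseteq> \<A>" and disj: "pairwise disjnt \<D>" using DZ by (auto simp: \<Z>_def)
  have hit: "A \<inter> \<Union>\<D> \<noteq> {}" if "A \<in> \<A>" for A
  proof (rule ccontr)
    define F where "F = {A \<in> \<A>. A \<inter> \<Union>\<D> = {}}"
    assume "\<not> ?thesis"
    with that have AF: "A \<in> F" by (auto simp: F_def)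
    have bdd: "bdd_above (measure M ` F)"
      by (rule bdd_aboveI2[where M="measure M S"]) (use inS S sub in \<open>auto simp: F_def intro!: ball_mono\<close>)
    define m where "m = (SUP A\<in>F. measure M A)"
    have "measure M A \<le> m" unfolding m_def using AF bdd by (rule cSUP_upper)
    moreover have "0 < measure M A" using AF sub by (auto simp: F_def intro: ball_pos)
    ultimately have "m / 2 < m" by simp
    then obtain A\<^sub>0 where A\<^sub>0: "A\<^sub>0 \<in> F" "m / 2 < measure M A\<^sub>0"
      unfolding m_def using less_cSUP_iff[OF _ bdd] AF by blast
    have "insert A\<^sub>0 \<D> \<in> \<Z>"
      unfolding \<Z>_def
    proof (intro CollectI conjI ballI impI)
      show "insert A\<^sub>0 \<D> \<subseteq> \<A>" using A\<^sub>0 DA by (auto simp: F_def)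
      show "pairwise disjnt (insert A\<^sub>0 \<D>)"
        using A\<^sub>0(1) disj by (auto simp: F_def pairwise_insert disjnt_def)
      fix A' assume A': "A' \<in> \<A>" "A' \<inter> \<Union>(insert A\<^sub>0 \<D>) \<noteq> {}"
      show "dom (insert A\<^sub>0 \<D>) A'"
      proof (cases "A' \<inter> \<Union>\<D> = {}")
        case True
        then have "A' \<in> F" using A' by (auto simp: F_def)
        then have "measure M A' \<le> m" unfolding m_def using bdd by (rule cSUP_upper)
        then have "measure M A' \<le> 2 * measure M A\<^sub>0" using A\<^sub>0 by simp
        then show ?thesis unfolding dom_def using A' True by blast
      next
        case False
        then have "dom \<D> A'" using DZ A' by (auto simp: \<Z>_def)
        then show ?thesis unfolding dom_def by blast
      qed
    qed
    then have "A\<^sub>0 \<in> \<D>" using max by blast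
    then have "A\<^sub>0 = {}" using A\<^sub>0(1) by (auto simp: F_def)
    then show False using A\<^sub>0(1) sub ball_nonempty by (auto simp: F_def)
  qed
  have "countable \<D>"
  proof -
    have "(measure M) summable_on \<D>"
    proof (rule nonneg_bdd_above_summable_on)
      show "bdd_above (sum (measure M) ` {F. F \<subseteq> \<D> \<and> finite F})"
      proof (rule bdd_aboveI2[where M="measure M S"])
        fix F assume F: "F \<in> {F. F \<subseteq> \<D> \<and> finite F}"
        have "sum (measure M) F = measure M (\<Union>F)"
          using measure_Union'[of F M] F DA sub disj
          by (metis (no_types, lifting) ball_fmeasurable mem_Collect_eq pairwise_subset subsetD)
        also have "\<dots> \<le> measure M S"
        proof (rule measure_mono_fmeasurable)
          show "\<Union>F \<subseteq> S" using F DA inS by blast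
          show "\<Union>F \<in> sets M" using F DA sub by (intro sets.finite_Union) (auto intro: ball_sets)
          show "S \<in> fmeasurable M" using S by simp
        qed
        finally show "sum (measure M) F \<le> measure M S" .
      qed
    qed auto
    then have "countable {A \<in> \<D>. measure M A \<noteq> 0}"
      by (rule summable_countable_real)
    moreover have "{A \<in> \<D>. measure M A \<noteq> 0} = \<D>" using DA sub ball_pos by force
    ultimately show ?thesis by simp
  qed
  moreover have "dom \<D> A" if "A \<in> \<A>" for A
    using DZ hit[OF that] that by (simp add: \<Z>_def)
  ultimately show thesis
    using that[of \<D>] DA disj by (simp add: dom_def)
qed

text \<open>
  Any two points share a ball, so the balls through \<open>x\<close> cover the space, and each of them lies in
  the hull of a ball through \<open>x\<close> of at least half its measure. Countably many measures are enough
  to dominate in this way, and a single one is enough when the measures are bounded; this is why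
  a space of finite measure is itself a ball.
\<close>

lemma space_covered_by_hulls:
  assumes x: "x \<in> space M"
  obtains P :: "nat \<Rightarrow> 'a set" where "\<And>n. P n \<in> \<B>" "\<And>n. x \<in> P n"
    "space M \<subseteq> (\<Union>n. hullb (P n))"
    "emeasure M (space M) < \<infinity> \<Longrightarrow> space M \<in> \<B>"
proof -
  define F where "F = {B \<in> \<B>. x \<in> B}"
  obtain B\<^sub>0 where "B\<^sub>0 \<in> F" using B2[OF x x] by (auto simp: F_def)
  have hull_mem: "A \<subseteq> hullb P" if "A \<in> F" "P \<in> F" "measure M A \<le> 2 * measure M P" for A P
    using that meeting_ball_subset_hull[of A P x] by (auto simp: F_def)
  have "\<exists>P\<in>F. \<forall>A\<in>F. measure M A \<le> c \<longrightarrow> measure M A \<le> 2 * measure M P" if "0 \<le> c" for c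
  proof (cases "\<exists>P\<in>F. c \<le> 2 * measure M P")
    case True
    then show ?thesis by force
  next
    case False
    then have bdd: "bdd_above (measure M ` F)"
      by (intro bdd_aboveI2[where M="c/2"]) force
    define m where "m = (SUP A\<in>F. measure M A)"
    have up: "measure M A \<le> m" if "A \<in> F" for A unfolding m_def using that bdd by (rule cSUP_upper)
    have "0 < m" using up[OF \<open>B\<^sub>0 \<in> F\<close>] ball_pos[of B\<^sub>0] \<open>B\<^sub>0 \<in> F\<close> by (auto simp: F_def)
    then have "m / 2 < m" by simp
    then obtain P where P: "P \<in> F" "m / 2 < measure M P"
      unfolding m_def using less_cSUP_iff[OF _ bdd] \<open>B\<^sub>0 \<in> F\<close> by blast
    have "measure M A \<le> 2 * measure M P" if "A \<in> F" for A
      using up[OF that] P by simp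
    then show ?thesis using P(1) by blast
  qed
  then have "\<forall>n. \<exists>P. P \<in> F \<and> (\<forall>A\<in>F. measure M A \<le> real n \<longrightarrow> measure M A \<le> 2 * measure M P)"
    by (metis of_nat_0_le_iff)
  then obtain P where P: "\<And>n. P n \<in> F"
    "\<And>n A. A \<in> F \<Longrightarrow> measure M A \<le> real n \<Longrightarrow> measure M A \<le> 2 * measure M (P n)"
    by metis
  have joined: "\<exists>A\<in>F. y \<in> A" if "y \<in> space M" for y
    using B2[OF x that] by (auto simp: F_def)
  have "space M \<subseteq> (\<Union>n. hullb (P n))"
  proof
    fix y assume "y \<in> space M"
    then obtain A where A: "A \<in> F" "y \<in> A" using joined by blast
    obtain n where "measure M A \<le> real n" using real_arch_simple by blast
    then have "A \<subseteq> hullb (P n)" using hull_mem[OF A(1) P(1)] P(2)[OF A(1)] by blast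
    then show "y \<in> (\<Union>n. hullb (P n))" using A by blast
  qed
  moreover have "space M \<in> \<B>" if fin: "emeasure M (space M) < \<infinity>"
  proof -
    obtain n where n: "measure M (space M) \<le> real n" using real_arch_simple by blast
    have "space M \<subseteq> hullb (P n)"
    proof
      fix y assume "y \<in> space M"
      then obtain A where A: "A \<in> F" "y \<in> A" using joined by blast
      have "measure M A \<le> measure M (space M)"
        using A fin by (intro measure_mono_fmeasurable) (auto simp: F_def ball_in_space intro!: fmeasurableI)
      then have "A \<subseteq> hullb (P n)" using hull_mem[OF A(1) P(1)[of n]] P(2)[OF A(1), of n] n by linarith
      then show "y \<in> hullb (P n)" using A by blast
    qed
    moreover have "hullb (P n) \<in> \<B>" using P(1)[of n] by (auto simp: F_def hull_ball)
    ultimately show ?thesis using ball_in_space[of "hullb (P n)"] by (metis subsetI subset_antisym)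
  qed
  ultimately show thesis using that[of P] P(1) by (auto simp: F_def)
qed

end

section \<open>Functions of bounded mean oscillation\<close>

definition mean :: "'a measure \<Rightarrow> 'a set \<Rightarrow> ('a \<Rightarrow> real) \<Rightarrow> real" where
  "mean M B g = (LINT x:B|M. g x) / measure M B"

text \<open>
  A real function on a doubling ball-basis whose mean oscillation is at most \<open>s\<close> on every ball. The
  bound \<open>s\<close> is kept strictly positive so that it can serve as a unit of height; a vanishing BMO norm
  is reached in the limit.
\<close>

locale bounded_oscillation = ball_basis M \<B> hullb K
  for M :: "'a measure" and \<B> :: "'a set set" and hullb :: "'a set \<Rightarrow> 'a set" and K :: real +
  fixes \<eta> :: real and g :: "'a \<Rightarrow> real" and s :: real
  assumes doubling: "doubling_basis M \<B> hullb \<eta>"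
    and ball_integrable: "B \<in> \<B> \<Longrightarrow> set_integrable M B g"
    and oscillation: "B \<in> \<B> \<Longrightarrow> (LINT x:B|M. \<bar>g x - mean M B g\<bar>) \<le> s * measure M B"
    and s_pos: "0 < s"
begin

lemma eta_gt_2: "2 < \<eta>"
  using doubling by (simp add: doubling_basis_def)

lemma const_integrable: "B \<in> \<B> \<Longrightarrow> set_integrable M B (\<lambda>x. c :: real)"
  unfolding set_integrable_def using B1[of B] by simp

lemma dev_integrable: "B \<in> \<B> \<Longrightarrow> set_integrable M B (\<lambda>x. \<bar>g x - c\<bar>)"
  by (intro set_integrable_abs set_integral_diff ball_integrable const_integrable)

lemma const_integral: "B \<in> \<B> \<Longrightarrow> (LINT x:B|M. (c::real)) = c * measure M B"
  using set_integral_const[of B M c] B1[of B] by (simp add: less_top mult.commute)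

lemma mean_dev_le:
  assumes "P \<in> \<B>" "Q \<in> \<B>" "P \<subseteq> Q"
  shows "\<bar>mean M P g - c\<bar> * measure M P \<le> (LINT x:Q|M. \<bar>g x - c\<bar>)"
proof -
  have "(mean M P g - c) * measure M P = (LINT x:P|M. g x - c)"
    using assms ball_pos[of P]
    by (simp add: set_integral_diff ball_integrable const_integrable const_integral mean_def field_simps)
  then have "\<bar>mean M P g - c\<bar> * measure M P = \<bar>LINT x:P|M. g x - c\<bar>"
    by (metis abs_mult abs_of_nonneg measure_nonneg)
  also have "\<dots> \<le> (LINT x:P|M. \<bar>g x - c\<bar>)"
    unfolding set_lebesgue_integral_def
    by (rule order_trans[OF integral_abs_bound]) (simp add: abs_mult)
  also have "\<dots> \<le> (LINT x:Q|M. \<bar>g x - c\<bar>)"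
    unfolding set_lebesgue_integral_def
    using dev_integrable[OF assms(1), of c] dev_integrable[OF assms(2), of c] assms(3)
    by (intro integral_mono) (auto simp: set_integrable_def indicator_def)
  finally show ?thesis .
qed

lemma mean_nested:
  assumes "P \<in> \<B>" "Q \<in> \<B>" "P \<subseteq> Q" "measure M Q \<le> r * measure M P"
  shows "\<bar>mean M P g - mean M Q g\<bar> \<le> r * s"
proof -
  have "\<bar>mean M P g - mean M Q g\<bar> * measure M P \<le> s * measure M Q"
    using mean_dev_le[OF assms(1-3)] oscillation[OF assms(2)] by (rule order_trans)
  also have "\<dots> \<le> s * (r * measure M P)"
    using assms(4) s_pos by simp
  finally show ?thesis
    using ball_pos[OF assms(1)] by (simp add: mult.assoc[symmetric] mult.commute)
qed

lemma mean_hull: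
  assumes "P \<in> \<B>"
  shows "\<bar>mean M P g - mean M (hullb P) g\<bar> \<le> K * s"
  by (rule mean_nested) (use assms hull_ball ball_subset_hull hull_measure in auto)

lemma dev_on_ball:
  assumes "Q \<in> \<B>" "\<bar>mean M Q g - c\<bar> \<le> d"
  shows "(LINT x:Q|M. \<bar>g x - c\<bar>) \<le> (s + d) * measure M Q"
proof -
  have "(LINT x:Q|M. \<bar>g x - c\<bar>) \<le> (LINT x:Q|M. \<bar>g x - mean M Q g\<bar> + d)"
    using assms by (intro set_integral_mono set_integral_add dev_integrable const_integrable) auto
  also have "\<dots> = (LINT x:Q|M. \<bar>g x - mean M Q g\<bar>) + d * measure M Q"
    using assms by (simp add: set_integral_add dev_integrable const_integrable const_integral)
  finally show ?thesis using oscillation[OF assms(1)] by (simp add: algebra_simps)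
qed

text \<open>
  Doubling may multiply the measure by anything between 2 and \<open>\<eta>\<close>, so iterating it \<open>k\<close> times could
  overshoot the scale \<open>2^k\<close>. Doubling only when the current ball is still too small keeps the measure
  within a factor \<open>\<eta>\<close> of that scale, and each of the at most \<open>k\<close> steps moves the mean by at most
  \<open>\<eta> * s\<close>. This linear growth of the means produces the logarithm in \<open>modulus_integral\<close>.
\<close>

lemma growing_ball:
  assumes A: "A \<in> \<B>"
  shows "\<exists>P\<in>\<B>. A \<subseteq> P \<and> measure M P \<le> \<eta> * 2^k * measure M A \<and>
      \<bar>mean M A g - mean M P g\<bar> \<le> \<eta> * k * s \<and>
      (2^k * measure M A \<le> measure M P \<or> hullb P = space M)"
proof (induction k)
  case 0
  have "1 * measure M A \<le> \<eta> * measure M A"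
    using eta_gt_2 by (intro mult_right_mono) auto
  then show ?case using A by (intro bexI[of _ A]) auto
next
  case (Suc k)
  then obtain P where P: "P \<in> \<B>" "A \<subseteq> P" "measure M P \<le> \<eta> * 2^k * measure M A"
    "\<bar>mean M A g - mean M P g\<bar> \<le> \<eta> * k * s"
    "2^k * measure M A \<le> measure M P \<or> hullb P = space M" by blast
  have "\<eta> * k * s \<le> \<eta> * Suc k * s"
    using eta_gt_2 s_pos by (intro mult_right_mono mult_left_mono) auto
  note mono1 = order_trans[OF P(4) this]
  have "\<eta> * 2^k * measure M A \<le> \<eta> * 2^Suc k * measure M A"
    using eta_gt_2 by (intro mult_right_mono mult_left_mono) auto
  note mono2 = order_trans[OF P(3) this]
  show ?case
  proof (cases "hullb P = space M \<or> 2^Suc k * measure M A \<le> measure M P")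
    case True
    then show ?thesis using P(1,2) mono1 mono2 by (intro bexI[of _ P]) auto
  next
    case False
    then obtain P' where P': "P' \<in> \<B>" "P \<subseteq> P'" "2 * measure M P \<le> measure M P'"
      "measure M P' \<le> \<eta> * measure M P"
      using doubling P(1) unfolding doubling_basis_def by blast
    have "\<bar>mean M P g - mean M P' g\<bar> \<le> \<eta> * s"
      by (rule mean_nested) (use P P' in auto)
    then have "\<bar>mean M A g - mean M P' g\<bar> \<le> \<eta> * Suc k * s"
      using P(4) by (auto simp: algebra_simps abs_if split: if_splits)
    moreover have "measure M P' \<le> \<eta> * 2^Suc k * measure M A"
    proof -
      have "\<eta> * measure M P \<le> \<eta> * (2^Suc k * measure M A)"
        using False eta_gt_2 by (intro mult_left_mono) auto
      then show ?thesis using P'(4) by (simp add: mult.assoc)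
    qed
    moreover have "2^Suc k * measure M A \<le> measure M P'"
      using P(5) P'(3) False by auto
    ultimately show ?thesis using P(2) P'(1,2) by (intro bexI[of _ P']) auto
  qed
qed

text \<open>
  The hull of the ball grown to scale \<open>2^k\<close> stands for the dilate of \<open>A\<close> by that factor. When growth
  stops early the hull is the whole space, and the two domination properties hold trivially.
\<close>

lemma absorbing_ball:
  assumes A: "A \<in> \<B>"
  obtains Q where "Q \<in> \<B>" "A \<subseteq> Q" "measure M Q \<le> K * \<eta> * 2^k * measure M A"
    "\<bar>mean M A g - mean M Q g\<bar> \<le> (K + \<eta> * k) * s"
    "\<And>D. D \<in> \<B> \<Longrightarrow> A \<inter> D \<noteq> {} \<Longrightarrow> measure M D \<le> 2^Suc k * measure M A \<Longrightarrow> D \<subseteq> Q"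
    "\<And>D. D \<in> \<B> \<Longrightarrow> measure M D \<le> 2^k * measure M A \<Longrightarrow> measure M D \<le> measure M Q"
proof -
  obtain P where P: "P \<in> \<B>" "A \<subseteq> P" "measure M P \<le> \<eta> * 2^k * measure M A"
    "\<bar>mean M A g - mean M P g\<bar> \<le> \<eta> * k * s"
    "2^k * measure M A \<le> measure M P \<or> hullb P = space M" using growing_ball[OF A] by blast
  show thesis
  proof (rule that[of "hullb P"])
    show QB: "hullb P \<in> \<B>" using P hull_ball by auto
    show "A \<subseteq> hullb P" using P ball_subset_hull[of P] by auto
    have "K * measure M P \<le> K * (\<eta> * 2^k * measure M A)"
      using K_pos P by (intro mult_left_mono) auto
    then show "measure M (hullb P) \<le> K * \<eta> * 2^k * measure M A"
      using hull_measure[OF P(1)] by (simp add: mult.assoc)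
    show "\<bar>mean M A g - mean M (hullb P) g\<bar> \<le> (K + \<eta> * k) * s"
      using P(4) mean_hull[OF P(1)] by (simp add: algebra_simps abs_if split: if_splits)
    show "D \<subseteq> hullb P" if D: "D \<in> \<B>" "A \<inter> D \<noteq> {}" "measure M D \<le> 2^Suc k * measure M A" for D
      using P(5)
    proof
      assume "2^k * measure M A \<le> measure M P"
      then have "measure M D \<le> 2 * measure M P" using D(3) by simp
      then show ?thesis using meeting_ball_subset_hull[OF D(1) P(1)] D(2) P(2) by blast
    qed (use ball_in_space D in auto)
    show "measure M D \<le> measure M (hullb P)" if D: "D \<in> \<B>" "measure M D \<le> 2^k * measure M A" for D
      using P(5)
    proof
      assume "2^k * measure M A \<le> measure M P"
      also have "measure M P \<le> measure M (hullb P)"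
        using P QB ball_subset_hull by (intro ball_mono) auto
      finally show ?thesis using D(2) by simp
    next
      assume "hullb P = space M"
      then show ?thesis using D QB ball_in_space by (intro ball_mono) auto
    qed
  qed
qed

end

section \<open>Countable sums of outer measures and integrals\<close>

lemma outer_measure_of_UN_le:
  assumes "countable I" and "\<And>i. i \<in> I \<Longrightarrow> F i \<subseteq> space M"
  shows "outer_measure_of M (\<Union>i\<in>I. F i) \<le> (\<integral>\<^sup>+i. outer_measure_of M (F i) \<partial>count_space I)"
proof -
  have "\<exists>E. \<forall>i\<in>I. E i \<in> sets M \<and> F i \<subseteq> E i \<and> outer_measure_of M (F i) = emeasure M (E i)"
    using outer_measure_of_attain[OF assms(2)] by (intro bchoice) blast
  then obtain E where E: "\<And>i. i \<in> I \<Longrightarrow> E i \<in> sets M" "\<And>i. i \<in> I \<Longrightarrow> F i \<subseteq> E i"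
    "\<And>i. i \<in> I \<Longrightarrow> outer_measure_of M (F i) = emeasure M (E i)" by blast
  have U: "(\<Union>i\<in>I. E i) \<in> sets M" using E(1) assms(1) by (intro sets.countable_UN') auto
  have "outer_measure_of M (\<Union>i\<in>I. F i) \<le> outer_measure_of M (\<Union>i\<in>I. E i)"
    using E(2) by (intro outer_measure_of_mono) blast
  also have "\<dots> = (\<integral>\<^sup>+x. indicator (\<Union>i\<in>I. E i) x \<partial>M)"
    using U by simp
  also have "\<dots> \<le> (\<integral>\<^sup>+x. (\<integral>\<^sup>+i. indicator (E i) x \<partial>count_space I) \<partial>M)"
  proof (rule nn_integral_mono)
    fix x
    show "indicator (\<Union>i\<in>I. E i) x \<le> (\<integral>\<^sup>+i. indicator (E i) x \<partial>count_space I)"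
    proof (cases "x \<in> (\<Union>i\<in>I. E i)")
      case True
      then obtain i where i: "i \<in> I" "x \<in> E i" by blast
      have "indicator (\<Union>i\<in>I. E i) x = (indicator (E i) x :: ennreal)" using True i by simp
      also have "\<dots> \<le> (\<integral>\<^sup>+i. indicator (E i) x \<partial>count_space I)"
        by (rule nn_integral_ge_point[OF i(1)])
      finally show ?thesis .
    qed simp
  qed
  also have "\<dots> = (\<integral>\<^sup>+i. (\<integral>\<^sup>+x. indicator (E i) x \<partial>M) \<partial>count_space I)"
    using assms(1) E(1) by (intro nn_integral_count_space_nn_integral) auto
  also have "\<dots> = (\<integral>\<^sup>+i. outer_measure_of M (F i) \<partial>count_space I)"
    using E by (intro nn_integral_cong) simp
  finally show ?thesis .
qed

lemma nn_integral_disjoint_le: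
  assumes "countable \<D>" "pairwise disjnt \<D>" "\<And>D. D \<in> \<D> \<Longrightarrow> D \<in> sets M" "\<And>D. D \<in> \<D> \<Longrightarrow> D \<subseteq> S"
    and [measurable]: "h \<in> borel_measurable M"
  shows "(\<integral>\<^sup>+D. (\<integral>\<^sup>+x. h x * indicator D x \<partial>M) \<partial>count_space \<D>) \<le> (\<integral>\<^sup>+x. h x * indicator S x \<partial>M)"
proof -
  have "(\<integral>\<^sup>+D. (\<integral>\<^sup>+x. h x * indicator D x \<partial>M) \<partial>count_space \<D>)
      = (\<integral>\<^sup>+x. (\<integral>\<^sup>+D. h x * indicator D x \<partial>count_space \<D>) \<partial>M)"
    using assms(1,3) by (intro nn_integral_count_space_nn_integral[symmetric]) auto
  also have "\<dots> \<le> (\<integral>\<^sup>+x. h x * indicator S x \<partial>M)"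
  proof (rule nn_integral_mono)
    fix x
    show "(\<integral>\<^sup>+D. h x * indicator D x \<partial>count_space \<D>) \<le> h x * indicator S x"
    proof (cases "\<exists>D\<in>\<D>. x \<in> D")
      case True
      then obtain D0 where D0: "D0 \<in> \<D>" "x \<in> D0" by blast
      have "(\<integral>\<^sup>+D. h x * indicator D x \<partial>count_space \<D>)
          = (\<integral>\<^sup>+D. h x * indicator {D0} D \<partial>count_space \<D>)"
        using assms(2) D0
        by (intro nn_integral_cong) (auto simp: indicator_def pairwise_def disjnt_def)
      also have "\<dots> = h x"
        using D0 by (simp add: nn_integral_cmult_indicator)
      finally show ?thesis using D0 assms(4)[OF D0(1)] by (simp add: subset_iff)
    next
      case False
      then have "(\<integral>\<^sup>+D. h x * indicator D x \<partial>count_space \<D>) = (\<integral>\<^sup>+D. 0 \<partial>count_space \<D>)"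
        by (intro nn_integral_cong) (auto simp: indicator_def)
      then show ?thesis by simp
    qed
  qed
  finally show ?thesis .
qed

lemma term_le_suminf: "f n \<le> suminf f" for f :: "nat \<Rightarrow> ennreal"
  using sum_le_suminf[of f "{n}"] by simp

section \<open>Exponential decay of deviations\<close>

text \<open>
  Heights in units of \<open>s\<close>, for \<open>k\<close> and \<open>e\<close> the hull and the doubling constant. Disjoint balls on
  which the mean differs by \<open>stop_level * s\<close> from the mean over a ball \<open>B\<close> that they meet, and whose
  measures do not exceed that of \<open>B\<close>, have total measure at most \<open>\<mu>(B) / (8 * e * k)\<close>; their
  dilates by 4, costing a factor \<open>4 * e * k\<close>, still have at most half the measure of \<open>B\<close>. The
  summand \<open>e\<close> of \<open>level_step\<close> is the overshoot at a stopping ball, and \<open>k + 2 * e\<close> is the change of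
  mean from that ball to its dilate.
\<close>

definition stop_level :: "real \<Rightarrow> real \<Rightarrow> real" where
  "stop_level k e = 8 * e * k\<^sup>2 * (1 + k)"

definition level_step :: "real \<Rightarrow> real \<Rightarrow> real" where
  "level_step k e = stop_level k e + e + (k + 2 * e)"

context bounded_oscillation
begin

text \<open>
  The balls \<open>A\<close> lie in the hull of \<open>B\<close>, so the oscillation of \<open>g\<close> on that hull controls this set.
\<close>

definition deviation_set :: "'a set \<Rightarrow> real \<Rightarrow> 'a set" where
  "deviation_set B t =
    {x \<in> B. \<exists>A\<in>\<B>. x \<in> A \<and> measure M A \<le> measure M B \<and> t < \<bar>mean M A g - mean M B g\<bar>}"

lemma mean_comparable_meeting:
  assumes "A \<in> \<B>" "B \<in> \<B>" "x \<in> A" "x \<in> B" "measure M B \<le> measure M A" "measure M A \<le> r * measure M B"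
  shows "\<bar>mean M A g - mean M B g\<bar> \<le> (K + K * r) * s"
proof -
  have "measure M B \<le> 2 * measure M A" using assms(5) measure_nonneg[of M A] by linarith
  then have "B \<subseteq> hullb A"
    using assms by (intro meeting_ball_subset_hull[of _ _ x])
  moreover have "measure M (hullb A) \<le> K * r * measure M B"
    using hull_measure[OF assms(1)] mult_left_mono[OF assms(6), of K] K_pos
    by (subst mult.assoc) linarith
  ultimately have "\<bar>mean M B g - mean M (hullb A) g\<bar> \<le> K * r * s"
    using assms by (intro mean_nested hull_ball) auto
  then show ?thesis using mean_hull[OF assms(1)] by (simp add: algebra_simps abs_if split: if_splits)
qed

text \<open>
  Among the balls through \<open>x\<close> on which the mean deviates, take one of more than half the
  supremum of their measures. Its doubling is too large to be another such ball, so either the mean over the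
  doubling is close to the mean over \<open>B\<close>, or the doubling is larger than \<open>B\<close> but comparable to it,
  which forces the same conclusion. Hence the deviation on the chosen ball exceeds the threshold by
  at most one doubling step. No doubling exists only if the hull is the whole space, and then
  the ball is comparable to \<open>B\<close> and its mean does not deviate.
\<close>

lemma stopping_ball:
  assumes B: "B \<in> \<B>" and x: "x \<in> deviation_set B (\<kappa> * s)" and \<kappa>: "K + K * \<eta> \<le> \<kappa>"
  obtains A where "A \<in> \<B>" "x \<in> A" "measure M A \<le> measure M B"
    "\<kappa> * s < \<bar>mean M A g - mean M B g\<bar>" "\<bar>mean M A g - mean M B g\<bar> \<le> (\<kappa> + \<eta>) * s"
    "\<And>D. D \<in> \<B> \<Longrightarrow> x \<in> D \<Longrightarrow> measure M D \<le> measure M B \<Longrightarrow>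
       \<kappa> * s < \<bar>mean M D g - mean M B g\<bar> \<Longrightarrow> measure M D \<le> 2 * measure M A"
proof -
  define F where "F = {A \<in> \<B>. x \<in> A \<and> measure M A \<le> measure M B \<and> \<kappa> * s < \<bar>mean M A g - mean M B g\<bar>}"
  obtain A0 where A0: "A0 \<in> F" using x by (auto simp: F_def deviation_set_def)
  have xB: "x \<in> B" using x by (simp add: deviation_set_def)
  have bdd: "bdd_above (measure M ` F)"
    by (rule bdd_aboveI2[where M="measure M B"]) (auto simp: F_def)
  define m where "m = (SUP A\<in>F. measure M A)"
  have up: "measure M A \<le> m" if "A \<in> F" for A unfolding m_def using that bdd by (rule cSUP_upper)
  have "0 < m" using up[OF A0] ball_pos[of A0] A0 by (auto simp: F_def)
  then have "m / 2 < m" by simp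
  then obtain A where A: "A \<in> F" "m / 2 < measure M A"
    unfolding m_def using less_cSUP_iff[OF _ bdd] A0 by blast
  then have AB: "A \<in> \<B>" "x \<in> A" "measure M A \<le> measure M B" "\<kappa> * s < \<bar>mean M A g - mean M B g\<bar>"
    by (auto simp: F_def)
  have K1: "1 \<le> K" using K_ge_1[OF B] .
  have ge: "(K + K * \<eta>) * s \<le> \<kappa> * s" using \<kappa> s_pos by simp
  have "hullb A \<noteq> space M"
  proof
    assume X: "hullb A = space M"
    have "measure M (hullb A) \<le> K * measure M B"
      using hull_measure[OF AB(1)] mult_left_mono[OF AB(3), of K] K_pos by linarith
    then have "\<bar>mean M B g - mean M (hullb A) g\<bar> \<le> K * s"
      using B AB X ball_in_space by (intro mean_nested hull_ball) auto
    then have "\<bar>mean M A g - mean M B g\<bar> \<le> (K + K) * s"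
      using mean_hull[OF AB(1)] by (simp add: algebra_simps abs_if split: if_splits)
    also have "\<dots> \<le> (K + K * \<eta>) * s"
      using K1 eta_gt_2 s_pos by simp
    finally show False using AB(4) ge by simp
  qed
  then obtain A' where A': "A' \<in> \<B>" "A \<subseteq> A'" "2 * measure M A \<le> measure M A'"
      "measure M A' \<le> \<eta> * measure M A"
    using doubling AB(1) unfolding doubling_basis_def by blast
  have "\<bar>mean M A' g - mean M B g\<bar> \<le> \<kappa> * s"
  proof (cases "measure M A' \<le> measure M B")
    case True
    have "A' \<notin> F" using up[of A'] A(2) A'(3) by auto
    then show ?thesis using True A' AB by (auto simp: F_def)
  next
    case False
    have "\<eta> * measure M A \<le> \<eta> * measure M B" using AB(3) eta_gt_2 by simp
    then have "measure M A' \<le> \<eta> * measure M B" using A'(4) by simp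
    then have "\<bar>mean M A' g - mean M B g\<bar> \<le> (K + K * \<eta>) * s"
      using False A' AB xB B by (intro mean_comparable_meeting[of _ _ x]) auto
    then show ?thesis using ge by simp
  qed
  moreover have "\<bar>mean M A g - mean M A' g\<bar> \<le> \<eta> * s"
    by (rule mean_nested) (use A' AB in auto)
  ultimately have "\<bar>mean M A g - mean M B g\<bar> \<le> (\<kappa> + \<eta>) * s"
    by (simp add: algebra_simps abs_if split: if_splits)
  moreover have "measure M D \<le> 2 * measure M A"
    if "D \<in> \<B>" "x \<in> D" "measure M D \<le> measure M B" "\<kappa> * s < \<bar>mean M D g - mean M B g\<bar>" for D
    using up[of D] that A(2) by (simp add: F_def)
  ultimately show thesis using that[of A] AB by blast
qed

text \<open>
  Chebyshev's inequality: every ball of the family contributes at least \<open>\<kappa> * s\<close> times its measure to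
  the integral of \<open>\<bar>g - g\<^sub>B\<bar>\<close> over the hull of \<open>B\<close>, which the oscillation bound controls.
\<close>

lemma disjoint_stopping_balls_measure:
  assumes B: "B \<in> \<B>" and D: "countable \<D>" "pairwise disjnt \<D>" "\<D> \<subseteq> \<B>"
    and "\<And>A. A \<in> \<D> \<Longrightarrow> A \<subseteq> hullb B"
    and "\<And>A. A \<in> \<D> \<Longrightarrow> \<kappa> * s \<le> \<bar>mean M A g - mean M B g\<bar>"
    and \<kappa>: "0 \<le> \<kappa>"
  shows "ennreal \<kappa> * (\<integral>\<^sup>+A. emeasure M A \<partial>count_space \<D>) \<le> ennreal (K * (1 + K) * measure M B)"
proof -
  have HB: "hullb B \<in> \<B>" using B hull_ball by auto
  define h where "h x = indicator (hullb B) x * \<bar>g x - mean M B g\<bar>" for x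
  have h_int: "integrable M h"
    using dev_integrable[OF HB, of "mean M B g"] by (simp add: set_integrable_def h_def[abs_def])
  have hm[measurable]: "h \<in> borel_measurable M" using h_int by (rule borel_measurable_integrable)
  have inA: "ennreal (\<kappa> * s) * emeasure M A \<le> (\<integral>\<^sup>+x. ennreal (h x) * indicator A x \<partial>M)" if A: "A \<in> \<D>" for A
  proof -
    have AB: "A \<in> \<B>" and AH: "A \<subseteq> hullb B" using A D(3) assms(5) by auto
    have eq: "h x * indicator A x = indicator A x * \<bar>g x - mean M B g\<bar>" for x
      using AH by (auto simp: h_def indicator_def)
    have "\<kappa> * s * measure M A \<le> \<bar>mean M A g - mean M B g\<bar> * measure M A"
      using assms(6)[OF A] by (intro mult_right_mono) auto
    also have "\<dots> \<le> (LINT x:A|M. \<bar>g x - mean M B g\<bar>)"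
      by (rule mean_dev_le) (use AB in auto)
    also have "ennreal \<dots> = (\<integral>\<^sup>+x. ennreal (h x * indicator A x) \<partial>M)"
      using dev_integrable[OF AB, of "mean M B g"] unfolding set_lebesgue_integral_def set_integrable_def
      by (subst nn_integral_eq_integral) (auto simp: eq)
    also have "\<dots> = (\<integral>\<^sup>+x. ennreal (h x) * indicator A x \<partial>M)"
      by (intro nn_integral_cong) (auto simp: indicator_def)
    finally show ?thesis using \<kappa> s_pos by (simp add: ball_emeasure[OF AB] ennreal_mult[symmetric] ennreal_leI)
  qed
  have "ennreal (\<kappa> * s) * (\<integral>\<^sup>+A. emeasure M A \<partial>count_space \<D>)
      = (\<integral>\<^sup>+A. ennreal (\<kappa> * s) * emeasure M A \<partial>count_space \<D>)"
    by (rule nn_integral_cmult[symmetric]) simp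
  also have "\<dots> \<le> (\<integral>\<^sup>+A. (\<integral>\<^sup>+x. ennreal (h x) * indicator A x \<partial>M) \<partial>count_space \<D>)"
    using inA by (intro nn_integral_mono) simp
  also have "\<dots> \<le> (\<integral>\<^sup>+x. ennreal (h x) * indicator (space M) x \<partial>M)"
    by (rule nn_integral_disjoint_le) (use D ball_in_space in auto)
  also have "\<dots> = (\<integral>\<^sup>+x. ennreal (h x) \<partial>M)"
    by (intro nn_integral_cong) simp
  also have "\<dots> = ennreal (LINT x:hullb B|M. \<bar>g x - mean M B g\<bar>)"
    unfolding set_lebesgue_integral_def
    by (subst nn_integral_eq_integral[OF h_int]) (auto simp: h_def[abs_def])
  also have "\<dots> \<le> ennreal (s * (K * (1 + K) * measure M B))"
  proof (rule ennreal_leI)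
    have "(LINT x:hullb B|M. \<bar>g x - mean M B g\<bar>) \<le> (s + K * s) * measure M (hullb B)"
      using mean_hull[OF B] by (intro dev_on_ball HB) (simp add: abs_minus_commute)
    also have "\<dots> \<le> (s + K * s) * (K * measure M B)"
      using hull_measure[OF B] s_pos K_pos by (intro mult_left_mono) auto
    finally show "(LINT x:hullb B|M. \<bar>g x - mean M B g\<bar>) \<le> s * (K * (1 + K) * measure M B)"
      by (simp add: algebra_simps)
  qed
  finally have "ennreal s * (ennreal \<kappa> * (\<integral>\<^sup>+A. emeasure M A \<partial>count_space \<D>))
      \<le> ennreal s * ennreal (K * (1 + K) * measure M B)"
    using s_pos \<kappa> K_pos by (simp add: ennreal_mult mult_ac)
  then show ?thesis
    using s_pos by (subst (asm) ennreal_mult_le_mult_iff) auto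
qed

text \<open>
  The step of the John--Nirenberg argument. Select disjoint stopping balls and let \<open>Q A\<close> be the dilate
  by 4 of the selected ball \<open>A\<close>. A point where the deviation from \<open>g\<^sub>B\<close> exceeds
  \<open>t + level_step * s\<close> lies in some \<open>Q A\<close>, and a ball witnessing the deviation has at most twice the
  measure of the stopping ball of that point, hence is not larger than \<open>Q A\<close>. As the mean over
  \<open>Q A\<close> differs from \<open>g\<^sub>B\<close> by at most \<open>level_step * s\<close>, a deviation above \<open>t\<close> from that mean is left.
\<close>

lemma deviation_cover:
  assumes B: "B \<in> \<B>"
  obtains \<D> :: "'a set set" and Q :: "'a set \<Rightarrow> 'a set"
  where "countable \<D>" "\<And>A. A \<in> \<D> \<Longrightarrow> Q A \<in> \<B>"
    "\<And>t. 0 \<le> t \<Longrightarrow> deviation_set B (t + level_step K \<eta> * s) \<subseteq> (\<Union>A\<in>\<D>. deviation_set (Q A) t)"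
    "2 * (\<integral>\<^sup>+A. emeasure M (Q A) \<partial>count_space \<D>) \<le> emeasure M B"
proof -
  have K1: "1 \<le> K" using K_ge_1[OF B] .
  have \<kappa>: "K + K * \<eta> \<le> stop_level K \<eta>"
  proof -
    have "K \<le> K * \<eta>" using K1 eta_gt_2 by simp
    moreover have "1 * (K * \<eta>) \<le> K * (K * \<eta>)" using K1 eta_gt_2 by (intro mult_right_mono) auto
    ultimately have "K + K * \<eta> \<le> 2 * (K * (K * \<eta>))" by linarith
    also have "\<dots> \<le> 8 * (1 + K) * (K * (K * \<eta>))"
      using K1 eta_gt_2 by (intro mult_right_mono) auto
    finally show ?thesis by (simp add: stop_level_def algebra_simps power2_eq_square)
  qed
  have stop0: "0 < stop_level K \<eta>" using K1 eta_gt_2 by (simp add: stop_level_def)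
  \<comment> \<open>\<open>A\<close> is a stopping ball for the point \<open>x\<close>\<close>
  define stops where "stops x A \<longleftrightarrow> A \<in> \<B> \<and> x \<in> A \<and> measure M A \<le> measure M B \<and>
    stop_level K \<eta> * s < \<bar>mean M A g - mean M B g\<bar> \<and> \<bar>mean M A g - mean M B g\<bar> \<le> (stop_level K \<eta> + \<eta>) * s \<and>
    (\<forall>D\<in>\<B>. x \<in> D \<longrightarrow> measure M D \<le> measure M B \<longrightarrow>
       stop_level K \<eta> * s < \<bar>mean M D g - mean M B g\<bar> \<longrightarrow> measure M D \<le> 2 * measure M A)" for x A
  have "\<exists>A. stops x A" if "x \<in> deviation_set B (stop_level K \<eta> * s)" for x
    by (rule stopping_ball[OF B that \<kappa>]) (auto simp: stops_def)
  then obtain St where St: "\<And>x. x \<in> deviation_set B (stop_level K \<eta> * s) \<Longrightarrow> stops x (St x)"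
    by metis
  define \<A> where "\<A> = St ` deviation_set B (stop_level K \<eta> * s)"
  have \<A>B: "\<A> \<subseteq> \<B>" using St[unfolded stops_def] by (auto simp: \<A>_def)
  have \<A>H: "A \<subseteq> hullb B" if A: "A \<in> \<A>" for A
  proof -
    obtain x where x: "x \<in> deviation_set B (stop_level K \<eta> * s)" "A = St x"
      using A unfolding \<A>_def by blast
    then have "x \<in> B" by (simp add: deviation_set_def)
    moreover have "measure M A \<le> measure M B" using St[OF x(1), unfolded stops_def] x(2) by blast
    then have "measure M A \<le> 2 * measure M B" using measure_nonneg[of M B] by linarith
    ultimately show ?thesis using St[OF x(1), unfolded stops_def] x(2) B by (intro meeting_ball_subset_hull[of _ _ x]) auto
  qed
  obtain \<D> where \<D>: "\<D> \<subseteq> \<A>" "pairwise disjnt \<D>" "countable \<D>"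
    "\<And>A. A \<in> \<A> \<Longrightarrow> \<exists>D\<in>\<D>. A \<inter> D \<noteq> {} \<and> measure M A \<le> 2 * measure M D"
    using vitali_selection[OF \<A>B \<A>H hull_ball[OF B]] by blast
  \<comment> \<open>\<open>Q\<close> is a dilate of \<open>A\<close> by 4: twice for passing from a stopping ball to the selected ball that
    dominates it, and twice again for the balls through the point\<close>
  define absorbs where "absorbs A Q \<longleftrightarrow> Q \<in> \<B> \<and> A \<subseteq> Q \<and> measure M Q \<le> K * \<eta> * 2^2 * measure M A \<and>
    \<bar>mean M A g - mean M Q g\<bar> \<le> (K + \<eta> * real 2) * s \<and>
    (\<forall>D\<in>\<B>. A \<inter> D \<noteq> {} \<longrightarrow> measure M D \<le> 2^Suc 2 * measure M A \<longrightarrow> D \<subseteq> Q) \<and>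
    (\<forall>D\<in>\<B>. measure M D \<le> 2^2 * measure M A \<longrightarrow> measure M D \<le> measure M Q)" for A Q
  have "\<exists>Q. absorbs A Q" if "A \<in> \<D>" for A
  proof -
    have "A \<in> \<B>" using that \<D> \<A>B by auto
    then show ?thesis
      unfolding absorbs_def by (rule absorbing_ball[of A 2]) blast
  qed
  then obtain Q where Q: "\<And>A. A \<in> \<D> \<Longrightarrow> absorbs A (Q A)"
    by metis
  show thesis
  proof (rule that[of \<D> Q])
    show "countable \<D>" by fact
    show "Q A \<in> \<B>" if "A \<in> \<D>" for A using Q[OF that, unfolded absorbs_def] by blast
    show "deviation_set B (t + level_step K \<eta> * s) \<subseteq> (\<Union>A\<in>\<D>. deviation_set (Q A) t)" if t: "0 \<le> t" for t
    proof
      fix x assume x: "x \<in> deviation_set B (t + level_step K \<eta> * s)"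
      then obtain D where D: "D \<in> \<B>" "x \<in> D" "measure M D \<le> measure M B"
        "t + level_step K \<eta> * s < \<bar>mean M D g - mean M B g\<bar>" by (auto simp: deviation_set_def)
      have "stop_level K \<eta> * s \<le> t + level_step K \<eta> * s"
        using t s_pos K1 eta_gt_2 by (simp add: level_step_def algebra_simps)
      with D(4) have Dl: "stop_level K \<eta> * s < \<bar>mean M D g - mean M B g\<bar>" by simp
      with D have xd: "x \<in> deviation_set B (stop_level K \<eta> * s)" using x by (auto simp: deviation_set_def)
      note S = St[OF xd, unfolded stops_def]
      have "St x \<in> \<A>" using xd by (simp add: \<A>_def)
      then obtain A where A: "A \<in> \<D>" "St x \<inter> A \<noteq> {}" "measure M (St x) \<le> 2 * measure M A"
        using \<D>(4) by blast
      have DA: "measure M D \<le> 2^2 * measure M A"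
        using S D(1-3) Dl A(3) by fastforce
      have "measure M (St x) \<le> 8 * measure M A"
        using A(3) measure_nonneg[of M A] by linarith
      then have "measure M (St x) \<le> 2^Suc 2 * measure M A" by simp
      then have "St x \<subseteq> Q A" using Q[OF A(1), unfolded absorbs_def] S A(2) by blast
      then have xQ: "x \<in> Q A" using S by blast
      have DQ: "measure M D \<le> measure M (Q A)" using Q[OF A(1), unfolded absorbs_def] D(1) DA by blast
      obtain z where "z \<in> deviation_set B (stop_level K \<eta> * s)" "A = St z"
        using A(1) \<D>(1) unfolding \<A>_def by blast
      then have "\<bar>mean M A g - mean M B g\<bar> \<le> (stop_level K \<eta> + \<eta>) * s" using St[unfolded stops_def] by blast
      moreover have "\<bar>mean M A g - mean M (Q A) g\<bar> \<le> (K + \<eta> * real 2) * s" using Q[OF A(1), unfolded absorbs_def] by blast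
      ultimately have "\<bar>mean M (Q A) g - mean M B g\<bar> \<le> level_step K \<eta> * s"
        by (simp add: level_step_def algebra_simps abs_if split: if_splits)
      then have "t < \<bar>mean M D g - mean M (Q A) g\<bar>"
        using D(4) by (simp add: abs_if split: if_splits)
      then have "x \<in> deviation_set (Q A) t" using xQ D DQ by (auto simp: deviation_set_def)
      then show "x \<in> (\<Union>A\<in>\<D>. deviation_set (Q A) t)" using A(1) by blast
    qed
    have "ennreal (stop_level K \<eta>) * (\<integral>\<^sup>+A. emeasure M A \<partial>count_space \<D>) \<le> ennreal (K * (1 + K) * measure M B)"
    proof (rule disjoint_stopping_balls_measure[OF B \<D>(3,2)])
      fix A assume "A \<in> \<D>"
      then obtain z where "z \<in> deviation_set B (stop_level K \<eta> * s)" "A = St z"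
        using \<D>(1) unfolding \<A>_def by blast
      then show "stop_level K \<eta> * s \<le> \<bar>mean M A g - mean M B g\<bar>" using St[of z, unfolded stops_def] by auto
    qed (use \<D>(1) \<A>B \<A>H stop0 in auto)
    moreover have "stop_level K \<eta> = (K * (1 + K)) * (8 * \<eta> * K)"
      by (simp add: stop_level_def power2_eq_square)
    ultimately have "ennreal (K * (1 + K)) * (ennreal (8 * \<eta> * K) * (\<integral>\<^sup>+A. emeasure M A \<partial>count_space \<D>))
        \<le> ennreal (K * (1 + K)) * ennreal (measure M B)"
      using K1 eta_gt_2 by (simp add: ennreal_mult mult.assoc)
    then have small: "ennreal (8 * \<eta> * K) * (\<integral>\<^sup>+A. emeasure M A \<partial>count_space \<D>) \<le> emeasure M B"
      using K1 by (subst (asm) ennreal_mult_le_mult_iff) (auto simp: ball_emeasure[OF B])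
    have "(\<integral>\<^sup>+A. emeasure M (Q A) \<partial>count_space \<D>) \<le> (\<integral>\<^sup>+A. ennreal (4 * \<eta> * K) * emeasure M A \<partial>count_space \<D>)"
    proof (rule nn_integral_mono)
      fix A assume "A \<in> space (count_space \<D>)"
      then have A: "A \<in> \<D>" by simp
      then have AB: "A \<in> \<B>" using \<D>(1) \<A>B by blast
      have "measure M (Q A) \<le> 4 * \<eta> * K * measure M A" using Q[OF A, unfolded absorbs_def] by (simp add: mult_ac)
      then show "emeasure M (Q A) \<le> ennreal (4 * \<eta> * K) * emeasure M A"
        using Q[OF A, unfolded absorbs_def] AB K1 eta_gt_2 by (simp add: ball_emeasure ennreal_mult[symmetric] ennreal_leI)
    qed
    also have "\<dots> = ennreal (4 * \<eta> * K) * (\<integral>\<^sup>+A. emeasure M A \<partial>count_space \<D>)"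
      by (rule nn_integral_cmult) simp
    finally have "2 * (\<integral>\<^sup>+A. emeasure M (Q A) \<partial>count_space \<D>)
        \<le> 2 * (ennreal (4 * \<eta> * K) * (\<integral>\<^sup>+A. emeasure M A \<partial>count_space \<D>))"
      by (rule mult_left_mono) simp
    also have "\<dots> = ennreal (8 * \<eta> * K) * (\<integral>\<^sup>+A. emeasure M A \<partial>count_space \<D>)"
    proof -
      have "2 * ennreal (4 * \<eta> * K) = ennreal (8 * \<eta> * K)"
        using K1 eta_gt_2 by (simp add: ennreal_mult' [symmetric] flip: ennreal_numeral)
      then show ?thesis by (simp add: mult.assoc[symmetric])
    qed
    finally show "2 * (\<integral>\<^sup>+A. emeasure M (Q A) \<partial>count_space \<D>) \<le> emeasure M B"
      using small by (rule order_trans)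
  qed
qed

lemma deviation_set_subset: "deviation_set B t \<subseteq> B"
  by (auto simp: deviation_set_def)

text \<open>
  The John--Nirenberg inequality, in outer measure because the sets may be non-measurable, and for
  means instead of values of \<open>g\<close> because the maximal function is compared through means.
\<close>

theorem deviation_decay:
  "B \<in> \<B> \<Longrightarrow> 2^n * outer_measure_of M (deviation_set B (n * (level_step K \<eta> * s))) \<le> emeasure M B"
proof (induction n arbitrary: B)
  case 0
  have "outer_measure_of M (deviation_set B 0) \<le> outer_measure_of M B"
    by (intro outer_measure_of_mono deviation_set_subset)
  then show ?case using 0 by simp
next
  case (Suc n)
  have step: "0 \<le> level_step K \<eta>"
    using K_pos eta_gt_2 by (simp add: level_step_def stop_level_def)
  let ?t = "n * (level_step K \<eta> * s)"
  show ?case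
  proof (rule deviation_cover[OF Suc.prems])
    fix \<D> :: "'a set set" and Q :: "'a set \<Rightarrow> 'a set"
    assume C: "countable \<D>" "\<And>A. A \<in> \<D> \<Longrightarrow> Q A \<in> \<B>"
      "\<And>t. 0 \<le> t \<Longrightarrow> deviation_set B (t + level_step K \<eta> * s) \<subseteq> (\<Union>A\<in>\<D>. deviation_set (Q A) t)"
      "2 * (\<integral>\<^sup>+A. emeasure M (Q A) \<partial>count_space \<D>) \<le> emeasure M B"
    have "outer_measure_of M (deviation_set B (?t + level_step K \<eta> * s))
        \<le> outer_measure_of M (\<Union>A\<in>\<D>. deviation_set (Q A) ?t)"
      using step s_pos by (intro outer_measure_of_mono C(3)) simp
    also have "\<dots> \<le> (\<integral>\<^sup>+A. outer_measure_of M (deviation_set (Q A) ?t) \<partial>count_space \<D>)"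
      using C(1,2) ball_in_space deviation_set_subset by (intro outer_measure_of_UN_le) blast+
    finally have "2^n * outer_measure_of M (deviation_set B (?t + level_step K \<eta> * s))
        \<le> 2^n * (\<integral>\<^sup>+A. outer_measure_of M (deviation_set (Q A) ?t) \<partial>count_space \<D>)"
      by (rule mult_left_mono) simp
    also have "\<dots> = (\<integral>\<^sup>+A. 2^n * outer_measure_of M (deviation_set (Q A) ?t) \<partial>count_space \<D>)"
      by (rule nn_integral_cmult[symmetric]) simp
    also have "\<dots> \<le> (\<integral>\<^sup>+A. emeasure M (Q A) \<partial>count_space \<D>)"
      using Suc.IH C(2) by (intro nn_integral_mono) simp
    finally have "2 * (2^n * outer_measure_of M (deviation_set B (?t + level_step K \<eta> * s)))
        \<le> 2 * (\<integral>\<^sup>+A. emeasure M (Q A) \<partial>count_space \<D>)"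
      by (rule mult_left_mono) simp
    then have "2^Suc n * outer_measure_of M (deviation_set B (?t + level_step K \<eta> * s)) \<le> emeasure M B"
      using C(4) by (simp add: mult.assoc)
    moreover have "real (Suc n) * (level_step K \<eta> * s) = ?t + level_step K \<eta> * s"
      by (simp add: algebra_simps)
  ultimately show ?case by simp
  qed
qed

lemma level_step_pos: "0 < level_step K \<eta>"
  using K_pos eta_gt_2 by (simp add: level_step_def stop_level_def add_pos_pos)

lemma deviation_outer_measure:
  assumes "B \<in> \<B>"
  shows "outer_measure_of M (deviation_set B (n * (level_step K \<eta> * s))) \<le> ennreal ((1/2)^n) * emeasure M B"
proof -
  have "(2::ennreal)^n = ennreal (2^n)" by (simp flip: ennreal_power)
  then have "ennreal ((1/2)^n) * 2^n = ennreal ((1/2)^n * 2^n)"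
    by (simp only:) (rule ennreal_mult[symmetric], auto)
  also have "(1/2::real)^n * 2^n = 1" by (simp flip: power_mult_distrib)
  finally have one: "ennreal ((1/2)^n) * 2^n = 1" by simp
  have "outer_measure_of M (deviation_set B (n * (level_step K \<eta> * s)))
      = ennreal ((1/2)^n) * (2^n * outer_measure_of M (deviation_set B (n * (level_step K \<eta> * s))))"
    by (simp only: mult.assoc[symmetric] one mult_1)
  also have "\<dots> \<le> ennreal ((1/2)^n) * emeasure M B"
    by (intro mult_left_mono deviation_decay[OF assms]) simp
  finally show ?thesis .
qed

text \<open>
  If the whole space is a ball, no ball is excluded by size, and by the decay estimate some point
  avoids the deviation set. At such a point all means are close to the mean over the space.
\<close>

lemma sup_mean_finite_somewhere:
  assumes X: "space M \<in> \<B>"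
  shows "\<exists>x\<in>space M. (SUP A\<in>{A \<in> \<B>. x \<in> A}. ennreal (mean M A g)) < \<infinity>"
proof -
  have "\<not> space M \<subseteq> deviation_set (space M) (1 * (level_step K \<eta> * s))"
  proof
    assume "space M \<subseteq> deviation_set (space M) (1 * (level_step K \<eta> * s))"
    then have "outer_measure_of M (space M) \<le> outer_measure_of M (deviation_set (space M) (1 * (level_step K \<eta> * s)))"
      by (rule outer_measure_of_mono)
    also have "\<dots> \<le> ennreal (1/2) * emeasure M (space M)"
      using deviation_outer_measure[OF X, of 1] by simp
    also have "\<dots> = ennreal (1/2 * measure M (space M))"
      unfolding ball_emeasure[OF X] by (rule ennreal_mult[symmetric]) auto
    finally have "measure M (space M) \<le> 1/2 * measure M (space M)"
      by (simp only: ennreal_le_iff outer_measure_of_eq[OF sets.top] ball_emeasure[OF X]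
          zero_le_mult_iff measure_nonneg) simp
    then show False using ball_pos[OF X] by simp
  qed
  then obtain x where x: "x \<in> space M" "x \<notin> deviation_set (space M) (1 * (level_step K \<eta> * s))" by blast
  have "(SUP A\<in>{A \<in> \<B>. x \<in> A}. ennreal (mean M A g)) \<le> ennreal (mean M (space M) g + level_step K \<eta> * s)"
  proof (rule SUP_least)
    fix A assume "A \<in> {A \<in> \<B>. x \<in> A}"
    then have A: "A \<in> \<B>" "x \<in> A" by auto
    have "measure M A \<le> measure M (space M)"
      using A X ball_in_space by (intro ball_mono) auto
    then have "\<bar>mean M A g - mean M (space M) g\<bar> \<le> level_step K \<eta> * s"
      using x A by (auto simp: deviation_set_def not_less)
    then show "ennreal (mean M A g) \<le> ennreal (mean M (space M) g + level_step K \<eta> * s)"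
      by (intro ennreal_leI) simp
  qed
  then have "(SUP A\<in>{A \<in> \<B>. x \<in> A}. ennreal (mean M A g)) < \<infinity>"
    by (rule le_less_trans) simp
  then show ?thesis using x(1) by blast
qed

end

section \<open>Kernels and the modulus of continuity\<close>

lemma modulus_antimono:
  "modulus_of_continuity \<omega> c\<^sub>0 \<Longrightarrow> 1 \<le> u \<Longrightarrow> u \<le> v \<Longrightarrow> \<omega> v \<le> \<omega> u"
  unfolding modulus_of_continuity_def
  using monotone_onD[of "{1..}" "(\<le>)" "(\<lambda>x y. y \<le> x)" \<omega> u v] by simp

text \<open>
  Cauchy condensation. By monotonicity \<open>\<omega>\<close> is at least \<open>\<omega> (2^(k+1))\<close> on \<open>[2^k, 2^(k+1))\<close>, where
  \<open>log 2 (1 + t) \<ge> max 1 k \<ge> (k + 3) / 4\<close>; this bounds the term with index \<open>k + 2\<close>. The first two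
  terms are 1 and 4, because truncated subtraction turns the exponent \<open>k - 1\<close> into 0 for \<open>k = 0\<close>, and
  they are absorbed by 16 times the summand 1 of \<open>modulus_integral\<close>.
\<close>

lemma dyadic_sum_le_modulus_integral:
  assumes \<omega>: "modulus_of_continuity \<omega> c\<^sub>0"
  shows "(\<Sum>k. ennreal (\<omega> (2^(k-1)) * 2^k * (k+1))) \<le> 16 * modulus_integral \<omega>"
proof -
  have anti: "\<omega> v \<le> \<omega> u" if "1 \<le> u" "u \<le> v" for u v
    using modulus_antimono[OF \<omega> that] .
  have nonneg: "0 \<le> \<omega> u" if "1 \<le> u" for u
    using \<omega> that by (auto simp: modulus_of_continuity_def)
  have one: "\<omega> 1 = 1" using \<omega> by (simp add: modulus_of_continuity_def)
  define f where "f k = ennreal (\<omega> (2^(k-1)) * 2^k * (k+1))" for k :: nat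
  define I where "I k = {2^k..<2^Suc k :: real}" for k :: nat
  define a where "a k = \<omega> (2^Suc k) * ((real k + 3) / 4)" for k :: nat
  have a0: "0 \<le> a k" for k
    unfolding a_def by (intro mult_nonneg_nonneg nonneg one_le_power) auto
  have log_ge: "(real k + 3) / 4 \<le> log 2 (1 + t)" if "t \<in> I k" for k t
  proof -
    have t: "2^k \<le> t" "1 \<le> t" using that by (auto simp: I_def intro: order_trans[of 1 "2^k"])
    have "log 2 (2 ^ k) \<le> log 2 (1 + t)" using t by (intro log_mono) auto
    then have 1: "real k \<le> log 2 (1 + t)" by (simp add: log_pow_cancel)
    have "log 2 2 \<le> log 2 (1 + t)" using t by (intro log_mono) auto
    then have "1 \<le> log 2 (1 + t)" by simp
    with 1 show ?thesis by (cases k) auto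
  qed
  have fk: "f (k + 2) = 16 * (\<integral>\<^sup>+t. ennreal (a k) * indicator (I k) t \<partial>lborel)" for k
  proof -
    have "(\<integral>\<^sup>+t. ennreal (a k) * indicator (I k) t \<partial>lborel) = ennreal (a k) * ennreal (2^k)"
      by (subst nn_integral_cmult_indicator) (auto simp: I_def)
    also have "\<dots> = ennreal (a k * 2^k)" using a0 by (simp add: ennreal_mult)
    finally have "16 * (\<integral>\<^sup>+t. ennreal (a k) * indicator (I k) t \<partial>lborel) = ennreal (16 * (a k * 2^k))"
      using a0 by (simp add: ennreal_mult)
    also have "16 * (a k * 2^k) = \<omega> (2^(k+2-1)) * 2^(k+2) * (real (k+2) + 1)"
      by (simp add: a_def field_simps)
    finally show ?thesis by (simp add: f_def)
  qed
  have pw: "(\<Sum>k. ennreal (a k) * indicator (I k) t) \<le> ennreal (\<omega> t * log 2 (1 + t)) * indicator {1..} t" for t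
  proof (cases "\<exists>k. t \<in> I k")
    case True
    then obtain k where k: "t \<in> I k" by blast
    have t: "2^k \<le> t" "1 \<le> t" "t \<le> 2^Suc k" using k by (auto simp: I_def intro: order_trans[of 1 "2^k"])
    have disj: "t \<notin> I j" if "j \<noteq> k" for j
    proof
      assume j: "t \<in> I j"
      have "(2::real)^j < 2^Suc k" "(2::real)^k < 2^Suc j" using j k by (auto simp: I_def)
      then have "j < Suc k" "k < Suc j" by (metis one_less_numeral_iff power_less_imp_less_exp semiring_norm(76))+
      then show False using that by simp
    qed
    have "(\<Sum>j. ennreal (a j) * indicator (I j) t) = (\<Sum>j\<in>{k}. ennreal (a j) * indicator (I j) t)"
      using disj by (intro suminf_finite) auto
    also have "\<dots> = ennreal (a k)" using k by simp
    also have "\<dots> \<le> ennreal (\<omega> t * log 2 (1 + t))"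
      unfolding a_def using log_ge[OF k] anti[OF t(2,3)] nonneg[OF t(2)]
      by (intro ennreal_leI mult_mono) auto
    finally show ?thesis using t by simp
  next
    case False
    then have "(\<Sum>j. ennreal (a j) * indicator (I j) t) = (\<Sum>j. 0)" by (intro suminf_cong) simp
    then show ?thesis by simp
  qed
  have "(\<Sum>k. f (k + 2)) = 16 * (\<Sum>k. (\<integral>\<^sup>+t. ennreal (a k) * indicator (I k) t \<partial>lborel))"
    unfolding fk by (rule ennreal_suminf_cmult)
  also have "(\<Sum>k. (\<integral>\<^sup>+t. ennreal (a k) * indicator (I k) t \<partial>lborel))
      = (\<integral>\<^sup>+t. (\<Sum>k. ennreal (a k) * indicator (I k) t) \<partial>lborel)"
    by (rule nn_integral_suminf[symmetric]) (simp add: I_def)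
  also have "\<dots> \<le> (\<integral>\<^sup>+t. ennreal (\<omega> t * log 2 (1 + t)) * indicator {1..} t \<partial>lborel)"
    by (intro nn_integral_mono pw)
  finally have tail: "(\<Sum>k. f (k + 2)) \<le> 16 * (\<integral>\<^sup>+t\<in>{1..}. ennreal (\<omega> t * log 2 (1 + t)) \<partial>lborel)"
    by (simp add: mult_left_mono)
  have "(\<Sum>k. f k) = (\<Sum>k<2. f k) + (\<Sum>k. f (k + 2))"
    using suminf_offset[of f 2] by (simp add: add.commute)
  also have "(\<Sum>k<2. f k) = ennreal 1 + ennreal 4"
    by (simp add: f_def numeral_2_eq_2 one)
  also have "\<dots> = 5" by (simp flip: ennreal_plus)
  also have "5 + (\<Sum>k. f (k + 2)) \<le> 16 + 16 * (\<integral>\<^sup>+t\<in>{1..}. ennreal (\<omega> t * log 2 (1 + t)) \<partial>lborel)"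
    using tail by (intro add_mono) auto
  finally show ?thesis by (simp add: f_def modulus_integral_def distrib_left)
qed

definition kernel_const :: "real \<Rightarrow> real \<Rightarrow> real \<Rightarrow> real" where
  "kernel_const k e c\<^sub>2 = 16 * c\<^sub>2 * k * e * (1 + k + e)"

context bounded_oscillation
begin

text \<open>
  The infimum defining \<open>ball_dist\<close> has to be seen to range over a nonempty set before it is
  approached by a ball: of two meeting balls, the hull of the larger one contains the other.
\<close>

lemma ball_dist_less:
  assumes A: "A \<in> \<B>" and x: "x \<in> space M" and "ball_dist M \<B> x A < r"
  obtains D where "D \<in> \<B>" "A \<union> {x} \<subseteq> D" "measure M D < r"
proof -
  obtain a where a: "a \<in> A" using ball_nonempty[OF A] by blast
  obtain C where C: "C \<in> \<B>" "a \<in> C" "x \<in> C" using B2[OF ball_in_space[OF A a] x] by blast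
  have ne: "\<exists>D\<in>\<B>. A \<union> {x} \<subseteq> D"
  proof (cases "measure M A \<le> 2 * measure M C")
    case True
    then have "A \<subseteq> hullb C" by (rule meeting_ball_subset_hull[OF A C(1) _ a C(2)])
    moreover have "x \<in> hullb C" using ball_subset_hull[OF C(1)] C(3) by (rule subsetD)
    ultimately show ?thesis using hull_ball[OF C(1)] by (intro bexI[of _ "hullb C"]) auto
  next
    case False
    then have "measure M C \<le> 2 * measure M A"
      using measure_nonneg[of M C] by linarith
    then have "C \<subseteq> hullb A" by (rule meeting_ball_subset_hull[OF C(1) A _ C(2) a])
    then show ?thesis
      using ball_subset_hull[OF A] C(3) hull_ball[OF A] by (intro bexI[of _ "hullb A"]) auto
  qed
  have "\<exists>m\<in>measure M ` {D \<in> \<B>. A \<union> {x} \<subseteq> D}. m < r"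
  proof (rule cInf_lessD)
    show "measure M ` {D \<in> \<B>. A \<union> {x} \<subseteq> D} \<noteq> {}" using ne by blast
    show "Inf (measure M ` {D \<in> \<B>. A \<union> {x} \<subseteq> D}) < r" using assms(3) by (simp add: ball_dist_def)
  qed
  then show thesis using that by auto
qed

lemma ball_dist_ge:
  assumes A: "A \<in> \<B>" and x: "x \<in> space M"
  shows "measure M A \<le> ball_dist M \<B> x A"
proof (rule ccontr)
  assume "\<not> ?thesis"
  then have "ball_dist M \<B> x A < measure M A" by simp
  then obtain D where "D \<in> \<B>" "A \<union> {x} \<subseteq> D" "measure M D < measure M A"
    by (rule ball_dist_less[OF A x])
  then show False using ball_mono[OF A, of D] by auto
qed

text \<open>
  A point whose distance to \<open>A\<close> is at most \<open>2^k * \<mu>(A)\<close> lies in the dilate \<open>Q k\<close> of \<open>A\<close>, and for the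
  least such \<open>k\<close> the kernel there is at most \<open>c\<^sub>2 * \<omega> (2^(k-1)) / \<mu>(A)\<close>. On \<open>Q k\<close> the function deviates
  from its mean over \<open>A\<close> by \<open>O(k + 1) * s\<close> on average, so the layers sum up to the condensed integral.
\<close>

lemma kernel_deviation:
  assumes ker: "kernel_structure M \<B> \<omega> c\<^sub>0 c\<^sub>1 c\<^sub>2 \<phi>" and A: "A \<in> \<B>"
  shows "(\<integral>\<^sup>+x. ennreal \<bar>g x - mean M A g\<bar> * ennreal (\<phi> A x) \<partial>M)
    \<le> ennreal (kernel_const K \<eta> c\<^sub>2 * s) * modulus_integral \<omega>"
proof -
  have \<omega>: "modulus_of_continuity \<omega> c\<^sub>0" and c2: "0 < c\<^sub>2" using ker by (auto simp: kernel_structure_def)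
  have anti: "\<omega> v \<le> \<omega> u" if "1 \<le> u" "u \<le> v" for u v
    using modulus_antimono[OF \<omega> that] .
  have nonneg: "0 \<le> \<omega> u" if "1 \<le> u" for u
    using \<omega> that by (auto simp: modulus_of_continuity_def)
  define w where "w k = \<omega> (2^(k-1))" for k :: nat
  have w0: "0 \<le> w k" for k by (simp add: w_def nonneg)
  have K1: "1 \<le> K" using K_ge_1[OF A] .
  have A0: "0 < measure M A" using ball_pos[OF A] .
  define layer where "layer k Q \<longleftrightarrow> Q \<in> \<B> \<and> measure M Q \<le> K * \<eta> * 2^k * measure M A \<and>
    \<bar>mean M A g - mean M Q g\<bar> \<le> (K + \<eta> * k) * s \<and>
    (\<forall>D\<in>\<B>. A \<inter> D \<noteq> {} \<longrightarrow> measure M D \<le> 2^Suc k * measure M A \<longrightarrow> D \<subseteq> Q)" for k :: nat and Q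
  have "\<exists>Q. layer k Q" for k
    unfolding layer_def by (rule absorbing_ball[OF A, of k]) blast
  then obtain Q where layers: "\<And>k. layer k (Q k)" by metis
  have Q: "Q k \<in> \<B>" "measure M (Q k) \<le> K * \<eta> * 2^k * measure M A"
    "\<bar>mean M A g - mean M (Q k) g\<bar> \<le> (K + \<eta> * k) * s"
    "\<And>D. D \<in> \<B> \<Longrightarrow> A \<inter> D \<noteq> {} \<Longrightarrow> measure M D \<le> 2^Suc k * measure M A \<Longrightarrow> D \<subseteq> Q k" for k
    using layers[of k] unfolding layer_def by blast+
  define h where "h k x = indicator (Q k) x * \<bar>g x - mean M A g\<bar>" for k :: nat and x
  have h_int: "integrable M (h k)" for k
    using dev_integrable[OF Q(1)[of k], of "mean M A g"] by (simp add: set_integrable_def h_def[abs_def])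
  have [measurable]: "h k \<in> borel_measurable M" for k using h_int by (rule borel_measurable_integrable)
  have pw: "\<exists>k. x \<in> Q k \<and> \<phi> A x \<le> c\<^sub>2 / measure M A * w k" if x: "x \<in> space M" for x
  proof -
    define r where "r = ball_dist M \<B> x A / measure M A"
    have r1: "1 \<le> r" using ball_dist_ge[OF A x] A0 by (simp add: r_def)
    have le: "\<phi> A x \<le> c\<^sub>2 / measure M A * \<omega> r"
      using ker A x by (auto simp: kernel_structure_def r_def)
    obtain k0 where "r < 2^k0" using real_arch_pow[of 2 r] by auto
    then have ex: "\<exists>k. r \<le> 2^k" by (intro exI[of _ k0]) simp
    define k where "k = (LEAST k. r \<le> 2^k)"
    have rk: "r \<le> 2^k" unfolding k_def using ex by (rule LeastI_ex)
    have "2^(k-1) \<le> r"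
    proof (cases k)
      case (Suc j)
      then have "\<not> r \<le> 2^j" unfolding k_def using not_less_Least by (metis lessI)
      then show ?thesis using Suc by simp
    qed (use r1 in simp)
    then have "\<omega> r \<le> w k" unfolding w_def by (intro anti) auto
    then have "\<phi> A x \<le> c\<^sub>2 / measure M A * w k"
      using le c2 A0 by (meson divide_nonneg_pos less_imp_le mult_left_mono order_trans)
    moreover have "x \<in> Q k"
    proof -
      have "ball_dist M \<B> x A \<le> 2^k * measure M A" using rk A0 by (simp add: r_def field_simps)
      also have "\<dots> < 2^Suc k * measure M A" using A0 by simp
      finally obtain D where D: "D \<in> \<B>" "A \<union> {x} \<subseteq> D" "measure M D < 2^Suc k * measure M A"
        by (rule ball_dist_less[OF A x])
      then have "D \<subseteq> Q k" using ball_nonempty[OF A] by (intro Q(4)) auto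
      then show ?thesis using D by blast
    qed
    ultimately show ?thesis by blast
  qed
  have int_h: "(\<integral>\<^sup>+x. ennreal (h k x) \<partial>M) \<le> ennreal ((s + (K + \<eta> * k) * s) * (K * \<eta> * 2^k * measure M A))" for k
  proof -
    have "(\<integral>\<^sup>+x. ennreal (h k x) \<partial>M) = ennreal (LINT x:Q k|M. \<bar>g x - mean M A g\<bar>)"
      unfolding set_lebesgue_integral_def
      by (subst nn_integral_eq_integral[OF h_int]) (auto simp: h_def[abs_def])
    also have "\<dots> \<le> ennreal ((s + (K + \<eta> * k) * s) * measure M (Q k))"
      using Q(3)[of k] by (intro ennreal_leI dev_on_ball Q(1)) (simp add: abs_minus_commute)
    also have "\<dots> \<le> ennreal ((s + (K + \<eta> * k) * s) * (K * \<eta> * 2^k * measure M A))"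
      using Q(2)[of k] s_pos K1 eta_gt_2 by (intro ennreal_leI mult_left_mono) auto
    finally show ?thesis .
  qed
  have "(\<integral>\<^sup>+x. ennreal \<bar>g x - mean M A g\<bar> * ennreal (\<phi> A x) \<partial>M)
      \<le> (\<integral>\<^sup>+x. (\<Sum>k. ennreal (c\<^sub>2 / measure M A * w k) * ennreal (h k x)) \<partial>M)"
  proof (rule nn_integral_mono)
    fix x assume "x \<in> space M"
    from pw[OF this] obtain k where k: "x \<in> Q k" "\<phi> A x \<le> c\<^sub>2 / measure M A * w k" by blast
    have "ennreal \<bar>g x - mean M A g\<bar> * ennreal (\<phi> A x)
        \<le> ennreal (c\<^sub>2 / measure M A * w k) * ennreal (h k x)"
      using k by (subst mult.commute) (intro mult_mono ennreal_leI, auto simp: h_def)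
    also have "\<dots> \<le> (\<Sum>k. ennreal (c\<^sub>2 / measure M A * w k) * ennreal (h k x))"
      by (rule term_le_suminf)
    finally show "ennreal \<bar>g x - mean M A g\<bar> * ennreal (\<phi> A x)
        \<le> (\<Sum>k. ennreal (c\<^sub>2 / measure M A * w k) * ennreal (h k x))" .
  qed
  also have "\<dots> = (\<Sum>k. (\<integral>\<^sup>+x. ennreal (c\<^sub>2 / measure M A * w k) * ennreal (h k x) \<partial>M))"
    by (rule nn_integral_suminf) simp
  also have "\<dots> \<le> (\<Sum>k. ennreal (c\<^sub>2 * K * \<eta> * (1 + K + \<eta>) * s) * ennreal (\<omega> (2^(k-1)) * 2^k * (k+1)))"
  proof (intro suminf_le)
    fix k
    have "(\<integral>\<^sup>+x. ennreal (c\<^sub>2 / measure M A * w k) * ennreal (h k x) \<partial>M)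
        = ennreal (c\<^sub>2 / measure M A * w k) * (\<integral>\<^sup>+x. ennreal (h k x) \<partial>M)"
      by (rule nn_integral_cmult) simp
    also have "\<dots> \<le> ennreal (c\<^sub>2 / measure M A * w k) * ennreal ((s + (K + \<eta> * k) * s) * (K * \<eta> * 2^k * measure M A))"
      by (intro mult_left_mono int_h) simp
    also have "\<dots> = ennreal (c\<^sub>2 / measure M A * w k * ((s + (K + \<eta> * k) * s) * (K * \<eta> * 2^k * measure M A)))"
      using c2 A0 w0 s_pos K1 eta_gt_2 by (intro ennreal_mult[symmetric]) auto
    also have "c\<^sub>2 / measure M A * w k * ((s + (K + \<eta> * k) * s) * (K * \<eta> * 2^k * measure M A))
        = (c\<^sub>2 * K * \<eta> * s * w k * 2^k) * (1 + K + \<eta> * k)"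
      using A0 by (simp add: field_simps)
    also have "ennreal \<dots> \<le> ennreal ((c\<^sub>2 * K * \<eta> * s * w k * 2^k) * ((1 + K + \<eta>) * (k+1)))"
      using c2 K1 eta_gt_2 w0[of k] s_pos
      by (intro ennreal_leI mult_left_mono) (auto simp: algebra_simps)
    also have "(c\<^sub>2 * K * \<eta> * s * w k * 2^k) * ((1 + K + \<eta>) * (k+1))
        = (c\<^sub>2 * K * \<eta> * (1 + K + \<eta>) * s) * (w k * 2^k * (k+1))" by simp
    also have "ennreal \<dots> = ennreal (c\<^sub>2 * K * \<eta> * (1 + K + \<eta>) * s) * ennreal (w k * 2^k * (k+1))"
      using c2 K1 eta_gt_2 w0[of k] s_pos by (intro ennreal_mult) auto
    finally show "(\<integral>\<^sup>+x. ennreal (c\<^sub>2 / measure M A * w k) * ennreal (h k x) \<partial>M)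
        \<le> ennreal (c\<^sub>2 * K * \<eta> * (1 + K + \<eta>) * s) * ennreal (\<omega> (2^(k-1)) * 2^k * (k+1))"
      by (simp add: w_def)
  qed auto
  also have "\<dots> = ennreal (c\<^sub>2 * K * \<eta> * (1 + K + \<eta>) * s) * (\<Sum>k. ennreal (\<omega> (2^(k-1)) * 2^k * (k+1)))"
    by (rule ennreal_suminf_cmult)
  also have "\<dots> \<le> ennreal (c\<^sub>2 * K * \<eta> * (1 + K + \<eta>) * s) * (16 * modulus_integral \<omega>)"
    by (intro mult_left_mono dyadic_sum_le_modulus_integral[OF \<omega>]) simp
  also have "\<dots> = ennreal (kernel_const K \<eta> c\<^sub>2 * s) * modulus_integral \<omega>"
  proof -
    have "kernel_const K \<eta> c\<^sub>2 * s = (c\<^sub>2 * K * \<eta> * (1 + K + \<eta>) * s) * 16"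
      by (simp add: kernel_const_def)
    then have "ennreal (kernel_const K \<eta> c\<^sub>2 * s) = ennreal (c\<^sub>2 * K * \<eta> * (1 + K + \<eta>) * s) * 16"
      using c2 K1 eta_gt_2 s_pos by (simp only: ennreal_mult') (simp add: ennreal_mult)
    then show ?thesis by (simp add: mult.assoc)
  qed
  finally show ?thesis .
qed

end

section \<open>The maximal operator on functions of bounded oscillation\<close>

text \<open>
  The nonnegative function \<open>g\<close> will be the absolute value of a BMO function. Passing to it at once
  makes every average over a ball or against a kernel an integral of \<open>g\<close> itself.
\<close>

locale kernel_maximal = bounded_oscillation M \<B> hullb K \<eta> g s
  for M :: "'a measure" and \<B> :: "'a set set" and hullb :: "'a set \<Rightarrow> 'a set" and K \<eta> :: real
    and g :: "'a \<Rightarrow> real" and s :: real +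
  fixes \<omega> :: "real \<Rightarrow> real" and c\<^sub>0 c\<^sub>1 c\<^sub>2 \<eta>' :: real
    and \<phi> :: "'a set \<Rightarrow> 'a \<Rightarrow> real" and G :: "'a \<Rightarrow> 'a set set"
  assumes kernel: "kernel_structure M \<B> \<omega> c\<^sub>0 c\<^sub>1 c\<^sub>2 \<phi>"
    and basis: "basis_structure M \<B> \<eta>' G"
    and modulus_finite: "modulus_integral \<omega> < \<infinity>"
    and g_nonneg: "0 \<le> g x"
    and g_measurable [measurable]: "g \<in> borel_measurable M"
begin

definition kernel_avg :: "'a set \<Rightarrow> ennreal" where
  "kernel_avg A = (\<integral>\<^sup>+y. ennreal (g y) * ennreal (\<phi> A y) \<partial>M)"

definition kernel_max :: "'a \<Rightarrow> ennreal" where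
  "kernel_max x = (SUP A\<in>G x. kernel_avg A)"

definition kernel_err :: real where
  "kernel_err = kernel_const K \<eta> c\<^sub>2 * s * enn2real (modulus_integral \<omega>)"

lemma c2_pos: "0 < c\<^sub>2" using kernel by (simp add: kernel_structure_def)

lemma kernel_const_nonneg: "0 \<le> kernel_const K \<eta> c\<^sub>2"
  using c2_pos K_pos eta_gt_2 by (simp add: kernel_const_def)

lemma kernel_err_nonneg: "0 \<le> kernel_err"
  using kernel_const_nonneg s_pos by (simp add: kernel_err_def)

lemma kernel_deviation_err:
  assumes "A \<in> \<B>"
  shows "(\<integral>\<^sup>+x. ennreal \<bar>g x - mean M A g\<bar> * ennreal (\<phi> A x) \<partial>M) \<le> ennreal kernel_err"
proof -
  have "modulus_integral \<omega> = ennreal (enn2real (modulus_integral \<omega>))"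
    using modulus_finite by (simp add: less_top)
  then have "ennreal (kernel_const K \<eta> c\<^sub>2 * s) * modulus_integral \<omega> = ennreal kernel_err"
    unfolding kernel_err_def using kernel_const_nonneg s_pos
    by (metis enn2real_nonneg ennreal_mult less_imp_le mult_nonneg_nonneg)
  then show ?thesis using kernel_deviation[OF kernel assms] by simp
qed

lemma kernel_measurable: "A \<in> \<B> \<Longrightarrow> \<phi> A \<in> borel_measurable M"
  using kernel by (auto simp: kernel_structure_def)

lemma kernel_mass:
  assumes "A \<in> \<B>" shows "(\<integral>\<^sup>+x. ennreal (\<phi> A x) \<partial>M) = 1"
proof -
  have "integrable M (\<phi> A)" "(\<integral>x. \<phi> A x \<partial>M) = 1" "\<And>x. x \<in> space M \<Longrightarrow> 0 \<le> \<phi> A x"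
    using kernel assms by (auto simp: kernel_structure_def)
  then show ?thesis by (subst nn_integral_eq_integral) (auto intro!: AE_I2)
qed

lemma mean_nonneg: "0 \<le> mean M A g"
  unfolding mean_def set_lebesgue_integral_def
  by (intro divide_nonneg_nonneg integral_nonneg) (auto simp: g_nonneg)

text \<open>
  A kernel average and the mean over its ball are interchangeable up to \<open>kernel_err\<close>, since the
  kernel has mass 1. Everything below is about means over balls.
\<close>

lemma kernel_avg_close:
  assumes A: "A \<in> \<B>"
  shows "kernel_avg A \<le> ennreal (mean M A g + kernel_err)"
    and "ennreal (mean M A g) \<le> kernel_avg A + ennreal kernel_err"
proof -
  note [measurable] = kernel_measurable[OF A]
  let ?m = "mean M A g"
  let ?dev = "\<integral>\<^sup>+x. ennreal \<bar>g x - ?m\<bar> * ennreal (\<phi> A x) \<partial>M"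
  have const: "(\<integral>\<^sup>+x. ennreal ?m * ennreal (\<phi> A x) \<partial>M) = ennreal ?m"
    by (subst nn_integral_cmult) (simp_all add: kernel_mass[OF A])
  have "kernel_avg A \<le> (\<integral>\<^sup>+x. ennreal \<bar>g x - ?m\<bar> * ennreal (\<phi> A x) + ennreal ?m * ennreal (\<phi> A x) \<partial>M)"
    unfolding kernel_avg_def
  proof (rule nn_integral_mono)
    fix x
    have "ennreal (g x) \<le> ennreal (\<bar>g x - ?m\<bar> + ?m)" by (intro ennreal_leI) simp
    also have "\<dots> = ennreal \<bar>g x - ?m\<bar> + ennreal ?m" using mean_nonneg by (intro ennreal_plus) auto
    finally show "ennreal (g x) * ennreal (\<phi> A x)
        \<le> ennreal \<bar>g x - ?m\<bar> * ennreal (\<phi> A x) + ennreal ?m * ennreal (\<phi> A x)"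
      unfolding distrib_right[symmetric] by (rule mult_right_mono) simp
  qed
  also have "\<dots> = ?dev + ennreal ?m"
    by (subst nn_integral_add) (simp_all add: const)
  also have "\<dots> \<le> ennreal kernel_err + ennreal ?m"
    by (intro add_mono kernel_deviation_err[OF A] order_refl)
  finally show "kernel_avg A \<le> ennreal (?m + kernel_err)"
    using mean_nonneg kernel_err_nonneg by (simp add: add.commute)
  have "ennreal ?m = (\<integral>\<^sup>+x. ennreal ?m * ennreal (\<phi> A x) \<partial>M)" by (rule const[symmetric])
  also have "\<dots> \<le> (\<integral>\<^sup>+x. ennreal (g x) * ennreal (\<phi> A x) + ennreal \<bar>g x - ?m\<bar> * ennreal (\<phi> A x) \<partial>M)"
  proof (rule nn_integral_mono)
    fix x
    have "ennreal ?m \<le> ennreal (g x + \<bar>g x - ?m\<bar>)" by (intro ennreal_leI) simp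
    also have "\<dots> = ennreal (g x) + ennreal \<bar>g x - ?m\<bar>" using g_nonneg by (intro ennreal_plus) auto
    finally show "ennreal ?m * ennreal (\<phi> A x)
        \<le> ennreal (g x) * ennreal (\<phi> A x) + ennreal \<bar>g x - ?m\<bar> * ennreal (\<phi> A x)"
      unfolding distrib_right[symmetric] by (rule mult_right_mono) simp
  qed
  also have "\<dots> = kernel_avg A + ?dev"
    unfolding kernel_avg_def by (rule nn_integral_add) auto
  also have "\<dots> \<le> kernel_avg A + ennreal kernel_err"
    by (intro add_mono kernel_deviation_err[OF A] order_refl)
  finally show "ennreal ?m \<le> kernel_avg A + ennreal kernel_err" .
qed

definition base_err :: real where "base_err = 2 * kernel_err + \<eta>' * K * s"

lemma eta'_ge_1: "1 \<le> \<eta>'" using basis by (simp add: basis_structure_def)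

lemma base_err_nonneg: "0 \<le> base_err"
  using kernel_err_nonneg eta'_ge_1 K_pos s_pos by (simp add: base_err_def)

lemma enlarge_in_basis:
  assumes "B \<in> \<B>" "y \<in> B"
  obtains B' where "B' \<in> G y" "B' \<in> \<B>" "B \<subseteq> B'" "measure M B' \<le> \<eta>' * measure M B"
  using basis assms ball_in_space[OF assms] unfolding basis_structure_def by blast

text \<open>
  The heart of the BLO estimate. A ball \<open>A\<close> admissible at \<open>x\<close> that is larger than \<open>B\<close> has a hull
  containing \<open>B\<close>, so its mean is close to that of a ball admissible at \<open>y\<close>. If \<open>A\<close> is not larger than
  \<open>B\<close>, its mean is within \<open>t\<close> of the mean over \<open>B\<close>, by the choice of \<open>x\<close>, and \<open>B\<close> can be enlarged to
  a ball admissible at \<open>y\<close>. Two replacements of kernel averages by means account for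
  \<open>2 * kernel_err\<close> in \<open>base_err\<close>.
\<close>

lemma kernel_max_comparison:
  assumes B: "B \<in> \<B>" and x: "x \<in> B" "x \<notin> deviation_set B t" and y: "y \<in> B" and t: "0 \<le> t"
  shows "kernel_max x \<le> kernel_max y + ennreal (base_err + t)"
  unfolding kernel_max_def[of x]
proof (rule SUP_least)
  fix A assume AG: "A \<in> G x"
  have A: "A \<in> \<B>" "x \<in> A" using basis AG ball_in_space[OF B x(1)] by (auto simp: basis_structure_def)
  have K1: "1 \<le> K" using K_ge_1[OF B] .
  have "\<exists>A'\<in>G y. A' \<in> \<B> \<and> mean M A g \<le> mean M A' g + \<eta>' * K * s + t"
  proof (cases "measure M A \<le> measure M B")
    case True
    then have "\<bar>mean M A g - mean M B g\<bar> \<le> t"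
      using x A by (auto simp: deviation_set_def not_less)
    moreover obtain B' where B': "B' \<in> G y" "B' \<in> \<B>" "B \<subseteq> B'" "measure M B' \<le> \<eta>' * measure M B"
      using enlarge_in_basis[OF B y] .
    moreover have "\<bar>mean M B g - mean M B' g\<bar> \<le> \<eta>' * s"
      by (rule mean_nested) (use B B' in auto)
    moreover have "\<eta>' * s \<le> \<eta>' * K * s"
      using K1 eta'_ge_1 s_pos by (intro mult_right_mono) auto
    ultimately show ?thesis by (intro bexI[of _ B']) (auto simp: abs_if split: if_splits)
  next
    case False
    then have "measure M B \<le> 2 * measure M A" using measure_nonneg[of M A] by linarith
    then have sub: "B \<subseteq> hullb A" by (rule meeting_ball_subset_hull[OF B A(1) _ x(1) A(2)])
    obtain A' where A': "A' \<in> G y" "A' \<in> \<B>" "hullb A \<subseteq> A'" "measure M A' \<le> \<eta>' * measure M (hullb A)"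
      using enlarge_in_basis[OF hull_ball[OF A(1)]] sub y by blast
    have "\<eta>' * measure M (hullb A) \<le> \<eta>' * (K * measure M A)"
      using hull_measure[OF A(1)] eta'_ge_1 by (intro mult_left_mono) auto
    then have "measure M A' \<le> \<eta>' * K * measure M A" using A'(4) by (simp add: mult.assoc)
    moreover have "A \<subseteq> A'" using A'(3) ball_subset_hull[OF A(1)] by blast
    ultimately have "\<bar>mean M A g - mean M A' g\<bar> \<le> \<eta>' * K * s"
      by (intro mean_nested A A')
    then show ?thesis using A' t by (intro bexI[of _ A']) (auto simp: abs_if split: if_splits)
  qed
  then obtain A' where A': "A' \<in> G y" "A' \<in> \<B>" "mean M A g \<le> mean M A' g + \<eta>' * K * s + t" by blast
  have pos: "0 \<le> \<eta>' * K * s" using eta'_ge_1 K1 s_pos by simp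
  have "kernel_avg A \<le> ennreal (mean M A g + kernel_err)" by (rule kernel_avg_close(1)[OF A(1)])
  also have "\<dots> \<le> ennreal (mean M A' g + (kernel_err + \<eta>' * K * s + t))"
    using A'(3) by (intro ennreal_leI) simp
  also have "\<dots> = ennreal (mean M A' g) + ennreal (kernel_err + \<eta>' * K * s + t)"
    using pos t kernel_err_nonneg mean_nonneg by (intro ennreal_plus) auto
  also have "\<dots> \<le> (kernel_avg A' + ennreal kernel_err) + ennreal (kernel_err + \<eta>' * K * s + t)"
    by (intro add_mono kernel_avg_close(2)[OF A'(2)] order_refl)
  also have "\<dots> = kernel_avg A' + ennreal (base_err + t)"
    using pos t kernel_err_nonneg by (simp add: add.assoc base_err_def flip: ennreal_plus)
  also have "kernel_avg A' \<le> kernel_max y" unfolding kernel_max_def using A'(1) by (rule SUP_upper)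
  finally show "kernel_avg A \<le> kernel_max y + ennreal (base_err + t)" by simp
qed

text \<open>
  Compared with \<open>x\<^sub>0\<close>, the maximal function can be infinite only on the intersection of all deviation
  sets of the ball, which is a null set by their decay.
\<close>

lemma AE_kernel_max_finite_on_ball:
  assumes P: "P \<in> \<B>" "x\<^sub>0 \<in> P" and fin: "kernel_max x\<^sub>0 < \<infinity>"
  shows "AE x in M. x \<in> P \<longrightarrow> kernel_max x < \<infinity>"
proof -
  define Z where "Z = {x \<in> P. kernel_max x = \<infinity>}"
  have sub: "Z \<subseteq> deviation_set P (n * (level_step K \<eta> * s))" for n :: nat
  proof
    fix x assume x: "x \<in> Z"
    show "x \<in> deviation_set P (n * (level_step K \<eta> * s))"
    proof (rule ccontr)
      assume "x \<notin> deviation_set P (n * (level_step K \<eta> * s))"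
      then have "kernel_max x \<le> kernel_max x\<^sub>0 + ennreal (base_err + n * (level_step K \<eta> * s))"
        using x P level_step_pos s_pos by (intro kernel_max_comparison) (auto simp: Z_def)
      also have "\<dots> < \<infinity>" using fin by simp
      finally show False using x by (simp add: Z_def)
    qed
  qed
  have le: "outer_measure_of M Z \<le> ennreal ((1/2)^n * measure M P)" for n :: nat
    using order_trans[OF outer_measure_of_mono[OF sub[of n]] deviation_outer_measure[OF P(1)]]
    by (simp add: ball_emeasure[OF P(1)] ennreal_mult)
  have "(\<lambda>n. ennreal ((1/2)^n * measure M P)) \<longlonglongrightarrow> ennreal 0"
    by (intro tendsto_ennrealI tendsto_mult_left_zero LIMSEQ_realpow_zero) auto
  then have "outer_measure_of M Z \<le> ennreal 0"
    by (rule LIMSEQ_le_const) (use le in blast)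
  then have Z0: "outer_measure_of M Z = 0" by simp
  have "Z \<subseteq> space M" using ball_in_space[OF P(1)] by (auto simp: Z_def)
  from outer_measure_of_attain[OF this] Z0 obtain E where E: "E \<in> sets M" "Z \<subseteq> E" "emeasure M E = 0"
    by auto
  show ?thesis
    by (rule AE_I[OF _ E(3,1)]) (use E(2) in \<open>auto simp: Z_def less_top[symmetric]\<close>)
qed

lemma AE_kernel_max_finite:
  assumes x0: "x\<^sub>0 \<in> space M" and fin: "(SUP A\<in>{A \<in> \<B>. x\<^sub>0 \<in> A}. ennreal (mean M A g)) < \<infinity>"
  shows "AE x in M. kernel_max x < \<infinity>"
proof -
  have "kernel_max x\<^sub>0 \<le> (SUP A\<in>{A \<in> \<B>. x\<^sub>0 \<in> A}. ennreal (mean M A g)) + ennreal kernel_err"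
    unfolding kernel_max_def
  proof (rule SUP_least)
    fix A assume "A \<in> G x\<^sub>0"
    then have A: "A \<in> \<B>" "x\<^sub>0 \<in> A" using basis x0 by (auto simp: basis_structure_def)
    have "kernel_avg A \<le> ennreal (mean M A g) + ennreal kernel_err"
      using kernel_avg_close(1)[OF A(1)] mean_nonneg kernel_err_nonneg by simp
    also have "\<dots> \<le> (SUP A\<in>{A \<in> \<B>. x\<^sub>0 \<in> A}. ennreal (mean M A g)) + ennreal kernel_err"
      using A by (intro add_mono SUP_upper) auto
    finally show "kernel_avg A \<le> \<dots>" .
  qed
  also have "\<dots> < \<infinity>" using fin by simp
  finally have fin0: "kernel_max x\<^sub>0 < \<infinity>" .
  obtain P :: "nat \<Rightarrow> 'a set" where P: "\<And>n. P n \<in> \<B>" "\<And>n. x\<^sub>0 \<in> P n" "space M \<subseteq> (\<Union>n. hullb (P n))"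
    by (rule space_covered_by_hulls[OF x0]) blast
  have "AE x in M. x \<in> hullb (P n) \<longrightarrow> kernel_max x < \<infinity>" for n
    using subsetD[OF ball_subset_hull[OF P(1)] P(2)] P(1)
    by (intro AE_kernel_max_finite_on_ball[of _ x\<^sub>0] hull_ball fin0)
  then have "AE x in M. \<forall>n. x \<in> hullb (P n) \<longrightarrow> kernel_max x < \<infinity>"
    unfolding AE_all_countable by blast
  then show ?thesis by (rule AE_mp) (use P(3) in \<open>auto intro!: AE_I2\<close>)
qed

text \<open>
  The comparison holds for every \<open>y\<close> in \<open>B\<close>, so its left side minus the error is a lower bound on \<open>B\<close>,
  and thus at most the essential infimum. Almost everywhere finiteness provides a point of \<open>B\<close> where
  the maximal function is finite, so that the difference is not formed at an infinite value.
\<close>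

lemma excess_le:
  assumes B: "B \<in> \<B>" and x: "x \<in> B" "x \<notin> deviation_set B t" and t: "0 \<le> t"
    and fin: "AE x in M. kernel_max x < \<infinity>"
  shows "e2ennreal (enn2ereal (kernel_max x) - ess_inf_on M B (\<lambda>x. enn2ereal (kernel_max x)))
    \<le> ennreal (base_err + t)"
proof -
  have a0: "0 \<le> base_err + t" using base_err_nonneg t by simp
  have "\<exists>y\<in>B. kernel_max y < \<infinity>"
  proof (rule ccontr)
    assume no: "\<not> ?thesis"
    have "AE x in M. x \<notin> B"
      using fin by (rule AE_mp) (use no in \<open>auto intro!: AE_I2\<close>)
    then have "emeasure M B = 0"
      using AE_iff_measurable[OF ball_sets[OF B], of "\<lambda>x. x \<notin> B"] ball_in_space[OF B] by auto
    then show False using B1[OF B] by simp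
  qed
  then obtain y\<^sub>0 where "y\<^sub>0 \<in> B" "kernel_max y\<^sub>0 < \<infinity>" by blast
  then have "kernel_max x < \<infinity>"
    using kernel_max_comparison[OF B x _ t, of y\<^sub>0] le_less_trans by fastforce
  then obtain m where m: "0 \<le> m" "kernel_max x = ennreal m"
    by (cases "kernel_max x") auto
  have "ereal (m - (base_err + t)) \<le> enn2ereal (kernel_max y)" if y: "y \<in> B" for y
  proof (cases "kernel_max y")
    case (real r)
    have "ennreal m \<le> ennreal (r + (base_err + t))"
      using kernel_max_comparison[OF B x y t] m real a0 by (simp flip: ennreal_plus)
    then have "m \<le> r + (base_err + t)"
      using real a0 by (subst (asm) ennreal_le_iff) auto
    then show ?thesis using real by (simp add: enn2ereal_ennreal)
  qed simp
  then have "ereal (m - (base_err + t)) \<le> ess_inf_on M B (\<lambda>x. enn2ereal (kernel_max x))"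
    unfolding ess_inf_on_def by (intro Sup_upper) auto
  then have "enn2ereal (kernel_max x) - ess_inf_on M B (\<lambda>x. enn2ereal (kernel_max x))
      \<le> ereal m - ereal (m - (base_err + t))"
    using m by (intro ereal_minus_mono) (auto simp: enn2ereal_ennreal)
  also have "\<dots> = ereal (base_err + t)" by simp
  finally show ?thesis
    using e2ennreal_mono by fastforce
qed

text \<open>
  Layer cake: on the interval \<open>[n * \<Lambda>, (n + 1) * \<Lambda>)\<close> the level sets lie in the \<open>(n - 1)\<close>-st deviation
  set, because the first step of height \<open>\<Lambda>\<close> already covers \<open>base_err\<close>. Their outer measures are at
  most \<open>2 * (1/2)^n * \<mu>(B)\<close>, and these bounds
  sum up to \<open>4 * \<mu>(B)\<close>.
\<close>

lemma outer_excess_le: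
  assumes B: "B \<in> \<B>" and fin: "AE x in M. kernel_max x < \<infinity>"
    and \<Lambda>: "base_err + level_step K \<eta> * s \<le> \<Lambda>"
  shows "outer_integral_on M B (\<lambda>x. e2ennreal (enn2ereal (kernel_max x)
      - ess_inf_on M B (\<lambda>x. enn2ereal (kernel_max x)))) \<le> ennreal (4 * \<Lambda>) * emeasure M B"
proof -
  let ?u = "\<lambda>x. e2ennreal (enn2ereal (kernel_max x) - ess_inf_on M B (\<lambda>x. enn2ereal (kernel_max x)))"
  have Ls: "0 < level_step K \<eta> * s" using level_step_pos s_pos by simp
  have \<Lambda>0: "0 < \<Lambda>" using \<Lambda> Ls base_err_nonneg by linarith
  have level: "outer_measure_of M {x \<in> B. ennreal t < ?u x} \<le> ennreal (2 * (1/2)^n) * emeasure M B"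
    if n: "n * \<Lambda> \<le> t" for n t
  proof (cases n)
    case 0
    have "outer_measure_of M {x \<in> B. ennreal t < ?u x} \<le> outer_measure_of M B"
      by (rule outer_measure_of_mono) auto
    also have "\<dots> = 1 * emeasure M B" using B by simp
    also have "\<dots> \<le> ennreal 2 * emeasure M B" by (intro mult_right_mono) auto
    finally show ?thesis using 0 by simp
  next
    case (Suc k)
    have "k * (level_step K \<eta> * s) \<le> k * \<Lambda>" using \<Lambda> base_err_nonneg by (intro mult_left_mono) auto
    moreover have "n * \<Lambda> = k * \<Lambda> + \<Lambda>" using Suc by (simp add: algebra_simps)
    ultimately have t: "base_err + k * (level_step K \<eta> * s) \<le> t" using n \<Lambda> Ls by linarith
    have "{x \<in> B. ennreal t < ?u x} \<subseteq> deviation_set B (k * (level_step K \<eta> * s))"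
    proof (clarify, rule ccontr)
      fix x assume x: "x \<in> B" "ennreal t < ?u x" "x \<notin> deviation_set B (k * (level_step K \<eta> * s))"
      have "?u x \<le> ennreal (base_err + k * (level_step K \<eta> * s))"
        using Ls by (intro excess_le[OF B x(1,3) _ fin]) simp
      also have "\<dots> \<le> ennreal t" using t by (rule ennreal_leI)
      finally show False using x(2) by simp
    qed
    then have "outer_measure_of M {x \<in> B. ennreal t < ?u x} \<le> ennreal ((1/2)^k) * emeasure M B"
      using deviation_outer_measure[OF B] outer_measure_of_mono order_trans by meson
    then show ?thesis using Suc by simp
  qed
  define I where "I n = {n * \<Lambda>..<(real n + 1) * \<Lambda>}" for n :: nat
  have "outer_integral_on M B ?u
      \<le> (\<integral>\<^sup>+t. (\<Sum>n. ennreal (2 * (1/2)^n) * emeasure M B * indicator (I n) t) \<partial>lborel)"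
    unfolding outer_integral_on_def
  proof (rule nn_integral_mono)
    fix t :: real
    show "outer_measure_of M {x \<in> B. ennreal t < ?u x} * indicator {0<..} t
        \<le> (\<Sum>n. ennreal (2 * (1/2)^n) * emeasure M B * indicator (I n) t)"
    proof (cases "0 < t")
      case True
      define n where "n = nat \<lfloor>t / \<Lambda>\<rfloor>"
      have "real n = of_int \<lfloor>t / \<Lambda>\<rfloor>" using True \<Lambda>0 by (simp add: n_def)
      then have "real n \<le> t / \<Lambda>" "t / \<Lambda> < real n + 1" by linarith+
      then have tI: "t \<in> I n" using \<Lambda>0 by (auto simp: I_def field_simps)
      then have "outer_measure_of M {x \<in> B. ennreal t < ?u x} * indicator {0<..} t
          \<le> ennreal (2 * (1/2)^n) * emeasure M B * indicator (I n) t"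
        using level[of n t] True by (simp add: I_def)
      also have "\<dots> \<le> (\<Sum>n. ennreal (2 * (1/2)^n) * emeasure M B * indicator (I n) t)"
        by (rule term_le_suminf)
      finally show ?thesis .
    qed simp
  qed
  also have "\<dots> = (\<Sum>n. (\<integral>\<^sup>+t. ennreal (2 * (1/2)^n) * emeasure M B * indicator (I n) t \<partial>lborel))"
    by (rule nn_integral_suminf) (simp add: I_def)
  also have "\<dots> = (\<Sum>n. (ennreal \<Lambda> * emeasure M B) * ennreal (2 * (1/2)^n))"
  proof (rule suminf_cong)
    fix n
    have "emeasure lborel (I n) = ennreal \<Lambda>" using \<Lambda>0 by (simp add: I_def algebra_simps)
    then show "(\<integral>\<^sup>+t. ennreal (2 * (1/2)^n) * emeasure M B * indicator (I n) t \<partial>lborel)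
        = (ennreal \<Lambda> * emeasure M B) * ennreal (2 * (1/2)^n)"
      by (subst nn_integral_cmult_indicator) (auto simp: I_def mult_ac)
  qed
  also have "\<dots> = (ennreal \<Lambda> * emeasure M B) * (\<Sum>n. ennreal (2 * (1/2)^n))"
    by (rule ennreal_suminf_cmult)
  also have "(\<Sum>n. ennreal (2 * (1/2)^n)) = ennreal 4"
  proof -
    have "(\<lambda>n. 2 * (1/2 :: real)^n) sums (2 * (1 / (1 - 1/2)))"
      by (intro sums_mult geometric_sums) simp
    then have "(\<lambda>n. 2 * (1/2 :: real)^n) sums 4" by simp
    then show ?thesis by (intro suminf_ennreal_eq) auto
  qed
  also have "(ennreal \<Lambda> * emeasure M B) * ennreal 4 = ennreal (4 * \<Lambda>) * emeasure M B"
    using \<Lambda>0 by (simp add: ennreal_mult mult_ac)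
  finally show ?thesis .
qed

lemma blo_norm_kernel_max:
  assumes fin: "AE x in M. kernel_max x < \<infinity>" and \<Lambda>: "base_err + level_step K \<eta> * s \<le> \<Lambda>"
  shows "blo_norm M \<B> (\<lambda>x. enn2ereal (kernel_max x)) \<le> ennreal (4 * \<Lambda>)"
  unfolding blo_norm_def
proof (rule SUP_least)
  fix B assume B: "B \<in> \<B>"
  show "outer_integral_on M B (\<lambda>x. e2ennreal (enn2ereal (kernel_max x)
      - ess_inf_on M B (\<lambda>x. enn2ereal (kernel_max x)))) / emeasure M B \<le> ennreal (4 * \<Lambda>)"
    using outer_excess_le[OF B fin \<Lambda>] B1[OF B]
    by (intro divide_le_posI_ennreal) (auto simp: mult.commute)
qed

end

section \<open>Extended-valued functions and the BLO estimate\<close>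

text \<open>
  The three summands are two kernel errors, the change of mean under enlargement of a ball, and one
  step of the decay; only the first carries the factor \<open>modulus_integral\<close>, which is at least 1.
\<close>

definition blo_const :: "real \<Rightarrow> real \<Rightarrow> real \<Rightarrow> real \<Rightarrow> real" where
  "blo_const k e c e' = 2 * kernel_const k e c + e' * k + level_step k e"

text \<open>
  The factor 2 comes from comparing \<open>\<bar>f\<bar>\<close> first with \<open>\<bar>f\<^sub>B\<bar>\<close>, by the reverse triangle inequality, and
  then \<open>\<bar>f\<^sub>B\<bar>\<close> with the mean of \<open>\<bar>f\<bar>\<close>. The slack \<open>e\<close> makes the bound positive.
\<close>

lemma (in ball_basis) bounded_oscillation_abs_BMO:
  assumes dbl: "doubling_basis M \<B> hullb \<eta>" and f: "f \<in> BMO M \<B>" and e: "0 < e"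
  shows "bounded_oscillation M \<B> hullb K \<eta> (\<lambda>x. \<bar>real_of_ereal (f x)\<bar>)
    (2 * enn2real (bmo_norm M \<B> f) + e)"
proof unfold_locales
  define N where "N = enn2real (bmo_norm M \<B> f)"
  have fin: "bmo_norm M \<B> f < \<infinity>" and ae: "AE x in M. \<bar>f x\<bar> \<noteq> \<infinity>"
    and int: "\<And>B. B \<in> \<B> \<Longrightarrow> set_integrable M B (\<lambda>x. real_of_ereal (f x))"
    using f by (auto simp: BMO_def)
  have N: "bmo_norm M \<B> f = ennreal N" "0 \<le> N" using fin by (auto simp: N_def less_top)
  define r where "r x = real_of_ereal (f x)" for x
  show "doubling_basis M \<B> hullb \<eta>" by fact
  show "0 < 2 * enn2real (bmo_norm M \<B> f) + e" using e by (simp add: add_nonneg_pos)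
  fix B assume B: "B \<in> \<B>"
  show "set_integrable M B (\<lambda>x. \<bar>real_of_ereal (f x)\<bar>)"
    by (rule set_integrable_abs[OF int[OF B]])
  have rB: "set_integrable M B r" using int[OF B] by (simp add: r_def[abs_def])
  have cB: "set_integrable M B (\<lambda>x. c :: real)" for c
    unfolding set_integrable_def using B1[OF B] B by simp
  have cI: "(LINT x:B|M. (c::real)) = c * measure M B" for c
    using set_integral_const[of B M c] B1[OF B] B by (simp add: less_top mult.commute)
  define m where "m = ball_avg M B f"
  define a where "a = mean M B (\<lambda>x. \<bar>r x\<bar>)"
  have B0: "0 < measure M B" by (rule ball_pos[OF B])
  have devB: "set_integrable M B (\<lambda>x. \<bar>r x - m\<bar>)"
    by (intro set_integrable_abs set_integral_diff rB cB)
  have 1: "(LINT x:B|M. \<bar>r x - m\<bar>) \<le> N * measure M B"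
  proof -
    have "(\<integral>\<^sup>+x\<in>B. e2ennreal \<bar>f x - ereal m\<bar> \<partial>M) = (\<integral>\<^sup>+x. ennreal (indicator B x *\<^sub>R \<bar>r x - m\<bar>) \<partial>M)"
    proof (rule nn_integral_cong_AE, use ae in eventually_elim)
      case (elim x)
      then obtain z where "f x = ereal z" by (cases "f x") auto
      then show ?case by (auto simp: r_def indicator_def e2ennreal_ereal)
    qed
    also have "\<dots> = ennreal (LINT x:B|M. \<bar>r x - m\<bar>)"
      unfolding set_lebesgue_integral_def
      using devB by (intro nn_integral_eq_integral) (auto simp: set_integrable_def)
    finally have eq: "(\<integral>\<^sup>+x\<in>B. e2ennreal \<bar>f x - ereal m\<bar> \<partial>M) = ennreal (LINT x:B|M. \<bar>r x - m\<bar>)" .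
    have "(\<integral>\<^sup>+x\<in>B. e2ennreal \<bar>f x - ereal m\<bar> \<partial>M) / emeasure M B \<le> ennreal N"
      unfolding N(1)[symmetric] bmo_norm_def m_def using B by (rule SUP_upper)
    then have "ennreal ((LINT x:B|M. \<bar>r x - m\<bar>) / measure M B) \<le> ennreal N"
      unfolding eq ball_emeasure[OF B] using B0
      by (subst (asm) divide_ennreal) (auto simp: set_lebesgue_integral_def intro!: integral_nonneg)
    then show ?thesis using N(2) B0 by (simp add: ennreal_le_iff field_simps)
  qed
  have dev2: "set_integrable M B (\<lambda>x. \<bar>\<bar>r x\<bar> - c\<bar>)" for c
    by (intro set_integrable_abs set_integral_diff rB cB)
  have 2: "(LINT x:B|M. \<bar>\<bar>r x\<bar> - \<bar>m\<bar>\<bar>) \<le> (LINT x:B|M. \<bar>r x - m\<bar>)"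
    by (intro set_integral_mono dev2 devB) simp
  have 3: "\<bar>a - \<bar>m\<bar>\<bar> * measure M B \<le> (LINT x:B|M. \<bar>\<bar>r x\<bar> - \<bar>m\<bar>\<bar>)"
  proof -
    have "(a - \<bar>m\<bar>) * measure M B = (LINT x:B|M. \<bar>r x\<bar> - \<bar>m\<bar>)"
      using B0 by (simp add: set_integral_diff set_integrable_abs rB cB cI a_def mean_def field_simps)
    then have "\<bar>a - \<bar>m\<bar>\<bar> * measure M B = \<bar>LINT x:B|M. \<bar>r x\<bar> - \<bar>m\<bar>\<bar>"
      by (metis abs_mult abs_of_nonneg measure_nonneg)
    also have "\<dots> \<le> (LINT x:B|M. \<bar>\<bar>r x\<bar> - \<bar>m\<bar>\<bar>)"
      unfolding set_lebesgue_integral_def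
      by (rule order_trans[OF integral_abs_bound]) (simp add: abs_mult)
    finally show ?thesis .
  qed
  have "(LINT x:B|M. \<bar>\<bar>r x\<bar> - a\<bar>) \<le> (LINT x:B|M. \<bar>\<bar>r x\<bar> - \<bar>m\<bar>\<bar> + \<bar>a - \<bar>m\<bar>\<bar>)"
    by (intro set_integral_mono set_integral_add dev2 cB) simp
  also have "\<dots> = (LINT x:B|M. \<bar>\<bar>r x\<bar> - \<bar>m\<bar>\<bar>) + \<bar>a - \<bar>m\<bar>\<bar> * measure M B"
    by (simp add: set_integral_add dev2 cB cI)
  also have "\<dots> \<le> 2 * N * measure M B" using 1 2 3 by simp
  also have "\<dots> \<le> (2 * N + e) * measure M B" using e by (intro mult_right_mono) auto
  finally show "(LINT x:B|M. \<bar>\<bar>real_of_ereal (f x)\<bar> - mean M B (\<lambda>x. \<bar>real_of_ereal (f x)\<bar>)\<bar>)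
      \<le> (2 * enn2real (bmo_norm M \<B> f) + e) * measure M B"
    by (simp add: N_def a_def r_def[abs_def])
qed

lemma ennreal_abs_of_finite: "\<bar>z\<bar> \<noteq> \<infinity> \<Longrightarrow> e2ennreal \<bar>z\<bar> = ennreal \<bar>real_of_ereal z\<bar>"
  by (cases z) (auto simp: e2ennreal_ereal)

lemma KB_maximal_eq:
  assumes "AE x in M. \<bar>f x\<bar> \<noteq> \<infinity>"
  shows "KB_maximal M \<G> f x
    = (SUP A\<in>snd \<G> x. \<integral>\<^sup>+y. ennreal \<bar>real_of_ereal (f y)\<bar> * ennreal (fst \<G> A y) \<partial>M)"
proof -
  have "(\<integral>\<^sup>+y. e2ennreal \<bar>f y\<bar> * ennreal (fst \<G> A y) \<partial>M)
      = (\<integral>\<^sup>+y. ennreal \<bar>real_of_ereal (f y)\<bar> * ennreal (fst \<G> A y) \<partial>M)" for A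
    by (rule nn_integral_cong_AE) (use assms in \<open>eventually_elim, simp add: ennreal_abs_of_finite\<close>)
  then show ?thesis by (simp add: KB_maximal_def)
qed

lemma (in ball_basis) std_maximal_eq:
  assumes "f \<in> BMO M \<B>"
  shows "std_maximal M \<B> f x
    = (SUP A\<in>{A \<in> \<B>. x \<in> A}. ennreal (mean M A (\<lambda>y. \<bar>real_of_ereal (f y)\<bar>)))"
  unfolding std_maximal_def
proof (rule SUP_cong)
  fix A assume "A \<in> {A \<in> \<B>. x \<in> A}"
  then have A: "A \<in> \<B>" by simp
  let ?g = "\<lambda>y. \<bar>real_of_ereal (f y)\<bar>"
  have ae: "AE x in M. \<bar>f x\<bar> \<noteq> \<infinity>" using assms by (simp add: BMO_def)
  have int: "set_integrable M A ?g"
    by (rule set_integrable_abs) (use assms A in \<open>simp add: BMO_def\<close>)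
  have "(\<integral>\<^sup>+y\<in>A. e2ennreal \<bar>f y\<bar> \<partial>M) = (\<integral>\<^sup>+y. ennreal (indicator A y *\<^sub>R ?g y) \<partial>M)"
    by (rule nn_integral_cong_AE)
      (use ae in \<open>eventually_elim, auto simp: ennreal_abs_of_finite indicator_def\<close>)
  also have "\<dots> = ennreal (LINT y:A|M. ?g y)"
    unfolding set_lebesgue_integral_def
    by (intro nn_integral_eq_integral AE_I2 scaleR_nonneg_nonneg abs_ge_zero indicator_pos_le
        int[unfolded set_integrable_def])
  finally have eq: "(\<integral>\<^sup>+y\<in>A. e2ennreal \<bar>f y\<bar> \<partial>M) = ennreal (LINT y:A|M. ?g y)" .
  have "0 \<le> (LINT y:A|M. ?g y)"
    unfolding set_lebesgue_integral_def
    by (intro Bochner_Integration.integral_nonneg scaleR_nonneg_nonneg abs_ge_zero indicator_pos_le)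
  then show "(\<integral>\<^sup>+y\<in>A. e2ennreal \<bar>f y\<bar> \<partial>M) / emeasure M A = ennreal (mean M A ?g)"
    unfolding eq ball_emeasure[OF A] mean_def using ball_pos[OF A] by (rule divide_ennreal)
qed simp

lemma (in ball_basis) kernel_maximal_abs_BMO:
  assumes dbl: "doubling_basis M \<B> hullb \<eta>" and I: "modulus_integral \<omega> < \<infinity>"
    and KB: "KB_couple M \<B> \<omega> c\<^sub>0 c\<^sub>1 c\<^sub>2 \<eta>' \<G>" and f: "f \<in> BMO M \<B>" and e: "0 < e"
  shows "kernel_maximal M \<B> hullb K \<eta> (\<lambda>x. \<bar>real_of_ereal (f x)\<bar>)
    (2 * enn2real (bmo_norm M \<B> f) + e) \<omega> c\<^sub>0 c\<^sub>1 c\<^sub>2 \<eta>' (fst \<G>) (snd \<G>)"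
proof (rule kernel_maximal.intro)
  show "bounded_oscillation M \<B> hullb K \<eta> (\<lambda>x. \<bar>real_of_ereal (f x)\<bar>)
    (2 * enn2real (bmo_norm M \<B> f) + e)"
    by (rule bounded_oscillation_abs_BMO[OF dbl f e])
  have [measurable]: "f \<in> borel_measurable M" using f by (simp add: BMO_def)
  show "kernel_maximal_axioms M \<B> (\<lambda>x. \<bar>real_of_ereal (f x)\<bar>) \<omega> c\<^sub>0 c\<^sub>1 c\<^sub>2 \<eta>' (fst \<G>) (snd \<G>)"
  proof (rule kernel_maximal_axioms.intro)
    show "kernel_structure M \<B> \<omega> c\<^sub>0 c\<^sub>1 c\<^sub>2 (fst \<G>)" "basis_structure M \<B> \<eta>' (snd \<G>)"
      using KB by (auto simp: KB_couple_def)
    show "modulus_integral \<omega> < \<infinity>" by fact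
    show "0 \<le> \<bar>real_of_ereal (f x)\<bar>" for x by (rule abs_ge_zero)
    show "(\<lambda>x. \<bar>real_of_ereal (f x)\<bar>) \<in> borel_measurable M" by measurable
  qed
qed

text \<open>
  The estimate holds with \<open>2 * bmo_norm + e\<close> for every positive \<open>e\<close>; the constant does not depend on
  \<open>e\<close>, so \<open>e\<close> may tend to 0. The factor 8 is this 2 times the 4 of the layer-cake sum.
\<close>

lemma (in ball_basis) KB_maximal_BLO:
  assumes dbl: "doubling_basis M \<B> hullb \<eta>" and I: "modulus_integral \<omega> < \<infinity>"
    and KB: "KB_couple M \<B> \<omega> c\<^sub>0 c\<^sub>1 c\<^sub>2 \<eta>' \<G>" and f: "f \<in> BMO M \<B>"
    and x0: "x\<^sub>0 \<in> space M" "std_maximal M \<B> f x\<^sub>0 < \<infinity>"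
  shows "(\<lambda>x. enn2ereal (KB_maximal M \<G> f x)) \<in> BLO M \<B>"
    and "blo_norm M \<B> (\<lambda>x. enn2ereal (KB_maximal M \<G> f x))
      \<le> ennreal (8 * blo_const K \<eta> c\<^sub>2 \<eta>') * modulus_integral \<omega> * bmo_norm M \<B> f"
proof -
  let ?g = "\<lambda>x. \<bar>real_of_ereal (f x)\<bar>"
  define N where "N = enn2real (bmo_norm M \<B> f)"
  define i where "i = enn2real (modulus_integral \<omega>)"
  have fin: "bmo_norm M \<B> f < \<infinity>" and ae: "AE x in M. \<bar>f x\<bar> \<noteq> \<infinity>"
    using f by (auto simp: BMO_def)
  have N: "bmo_norm M \<B> f = ennreal N" "0 \<le> N" using fin by (auto simp: N_def less_top)
  have i: "modulus_integral \<omega> = ennreal i" "0 \<le> i" using I by (auto simp: i_def less_top)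
  have "1 \<le> modulus_integral \<omega>" by (simp add: modulus_integral_def)
  then have i1: "1 \<le> i" unfolding i(1) by (metis ennreal_1 ennreal_le_iff i(2))
  define C where "C = blo_const K \<eta> c\<^sub>2 \<eta>'"
  have main: "(AE x in M. KB_maximal M \<G> f x < \<infinity>) \<and> 0 < C \<and>
      blo_norm M \<B> (\<lambda>x. enn2ereal (KB_maximal M \<G> f x)) \<le> ennreal (4 * C * i * (2 * N + e))"
    if e: "0 < e" for e
  proof -
    interpret km: kernel_maximal M \<B> hullb K \<eta> ?g "2 * N + e" \<omega> c\<^sub>0 c\<^sub>1 c\<^sub>2 \<eta>' "fst \<G>" "snd \<G>"
      unfolding N_def by (rule kernel_maximal_abs_BMO[OF dbl I KB f e])
    have eq: "KB_maximal M \<G> f = km.kernel_max"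
      by (rule ext) (simp only: KB_maximal_eq[OF ae] km.kernel_max_def km.kernel_avg_def)
    have AEfin: "AE x in M. km.kernel_max x < \<infinity>"
      using km.AE_kernel_max_finite[OF x0(1)] x0(2) by (simp add: std_maximal_eq[OF f])
    have pos: "0 \<le> \<eta>' * K" using km.eta'_ge_1 K_pos by simp
    have "0 < C"
      unfolding C_def blo_const_def using km.kernel_const_nonneg km.level_step_pos pos by linarith
    moreover have "km.base_err + level_step K \<eta> * (2 * N + e) \<le> C * i * (2 * N + e)"
    proof -
      have "(\<eta>' * K + level_step K \<eta>) * 1 \<le> (\<eta>' * K + level_step K \<eta>) * i"
        using pos km.level_step_pos i1 by (intro mult_left_mono) auto
      then have "2 * (kernel_const K \<eta> c\<^sub>2 * i) + \<eta>' * K + level_step K \<eta> \<le> C * i"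
        by (simp add: C_def blo_const_def algebra_simps)
      then have "(2 * (kernel_const K \<eta> c\<^sub>2 * i) + \<eta>' * K + level_step K \<eta>) * (2 * N + e) \<le> C * i * (2 * N + e)"
        using N(2) e by (intro mult_right_mono) auto
      then show ?thesis
        unfolding km.base_err_def km.kernel_err_def i_def[symmetric] by (simp add: algebra_simps)
    qed
    then have "blo_norm M \<B> (\<lambda>x. enn2ereal (km.kernel_max x)) \<le> ennreal (4 * (C * i * (2 * N + e)))"
      by (rule km.blo_norm_kernel_max[OF AEfin])
    ultimately show ?thesis using AEfin by (simp add: eq mult.assoc)
  qed
  have C0: "0 < C" using main[of 1] by simp
  have "blo_norm M \<B> (\<lambda>x. enn2ereal (KB_maximal M \<G> f x)) \<le> ennreal (8 * C * i * N)"
  proof (rule ennreal_le_epsilon)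
    fix e :: real assume e: "0 < e"
    have Ci: "0 < 4 * C * i" using C0 i1 by simp
    have "C \<noteq> 0" "i \<noteq> 0" using C0 i1 by auto
    then have "4 * C * i * (2 * N + e / (4 * C * i)) = 8 * C * i * N + e"
      by (simp add: distrib_left)
    then show "blo_norm M \<B> (\<lambda>x. enn2ereal (KB_maximal M \<G> f x)) \<le> ennreal (8 * C * i * N) + ennreal e"
      using main[of "e / (4 * C * i)"] Ci e C0 i N by (simp flip: ennreal_plus)
  qed
  also have "\<dots> = ennreal (8 * blo_const K \<eta> c\<^sub>2 \<eta>') * modulus_integral \<omega> * bmo_norm M \<B> f"
    using C0 i N by (simp add: C_def ennreal_mult)
  finally show bound: "blo_norm M \<B> (\<lambda>x. enn2ereal (KB_maximal M \<G> f x))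
      \<le> ennreal (8 * blo_const K \<eta> c\<^sub>2 \<eta>') * modulus_integral \<omega> * bmo_norm M \<B> f" .
  also have "\<dots> < \<infinity>" using I fin by (simp add: ennreal_mult_less_top)
  finally have "blo_norm M \<B> (\<lambda>x. enn2ereal (KB_maximal M \<G> f x)) < \<infinity>" .
  moreover have "AE x in M. \<bar>enn2ereal (KB_maximal M \<G> f x)\<bar> \<noteq> \<infinity>"
  proof -
    have "AE x in M. KB_maximal M \<G> f x < \<infinity>" using main[of 1] by simp
    then show ?thesis
    proof eventually_elim
      case (elim x)
      then show ?case by (cases "KB_maximal M \<G> f x") (auto simp: enn2ereal_ennreal)
    qed
  qed
  ultimately show "(\<lambda>x. enn2ereal (KB_maximal M \<G> f x)) \<in> BLO M \<B>"
    by (simp add: BLO_def)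
qed

lemma (in ball_basis) std_maximal_finite_somewhere:
  assumes dbl: "doubling_basis M \<B> hullb \<eta>" and f: "f \<in> BMO M \<B>"
    and fin: "emeasure M (space M) < \<infinity>" and ne: "x \<in> space M"
  shows "\<exists>y\<in>space M. std_maximal M \<B> f y < \<infinity>"
proof -
  interpret bo: bounded_oscillation M \<B> hullb K \<eta> "\<lambda>x. \<bar>real_of_ereal (f x)\<bar>"
      "2 * enn2real (bmo_norm M \<B> f) + 1"
    by (rule bounded_oscillation_abs_BMO[OF dbl f]) simp
  have "space M \<in> \<B>" by (rule space_covered_by_hulls[OF ne]) (use fin in blast)
  then show ?thesis
    unfolding std_maximal_eq[OF f] by (rule bo.sup_mean_finite_somewhere)
qed

theorem corollary1p1:
  fixes K \<eta> \<theta> c\<^sub>0 c\<^sub>1 c\<^sub>2 \<eta>' :: real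
  shows "\<exists>C::real. C > 0 \<and>
    (\<forall>(M :: 'a measure) \<B> hullb \<omega> \<G>.
       ball_basis M \<B> hullb K \<and> doubling_basis M \<B> hullb \<eta> \<and> regular_basis M \<B> hullb \<theta> \<and>
       modulus_integral \<omega> < \<infinity> \<and> KB_couple M \<B> \<omega> c\<^sub>0 c\<^sub>1 c\<^sub>2 \<eta>' \<G> \<longrightarrow>
       (\<forall>f \<in> BMO M \<B>.
          (\<exists>x\<in>space M. std_maximal M \<B> f x \<noteq> \<infinity>) \<longrightarrow>
          (\<lambda>x. enn2ereal (KB_maximal M \<G> f x)) \<in> BLO M \<B> \<and>
          blo_norm M \<B> (\<lambda>x. enn2ereal (KB_maximal M \<G> f x))
            \<le> ennreal C * modulus_integral \<omega> * bmo_norm M \<B> f) \<and>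
       (emeasure M (space M) < \<infinity> \<longrightarrow>
         (\<forall>f \<in> BMO M \<B>.
            (\<lambda>x. enn2ereal (KB_maximal M \<G> f x)) \<in> BLO M \<B> \<and>
            blo_norm M \<B> (\<lambda>x. enn2ereal (KB_maximal M \<G> f x))
              \<le> ennreal C * modulus_integral \<omega> * bmo_norm M \<B> f)))"
proof -
  \<comment> \<open>the maximum with 1 keeps \<open>C\<close> positive for parameters to which no ball-basis belongs\<close>
  define C where "C = max 1 (8 * blo_const K \<eta> c\<^sub>2 \<eta>')"
  have le: "ennreal (8 * blo_const K \<eta> c\<^sub>2 \<eta>') * a * b \<le> ennreal C * a * b" for a b
    unfolding C_def by (intro mult_right_mono ennreal_leI) auto
  have bounded: "(\<lambda>x. enn2ereal (KB_maximal M \<G> f x)) \<in> BLO M \<B> \<and>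
      blo_norm M \<B> (\<lambda>x. enn2ereal (KB_maximal M \<G> f x)) \<le> ennreal C * modulus_integral \<omega> * bmo_norm M \<B> f"
    if "ball_basis M \<B> hullb K" "doubling_basis M \<B> hullb \<eta>" "modulus_integral \<omega> < \<infinity>"
      "KB_couple M \<B> \<omega> c\<^sub>0 c\<^sub>1 c\<^sub>2 \<eta>' \<G>" "f \<in> BMO M \<B>" "x \<in> space M" "std_maximal M \<B> f x < \<infinity>"
    for M :: "'a measure" and \<B> hullb \<omega> \<G> f x
    using ball_basis.KB_maximal_BLO[OF that] order_trans[OF _ le] by blast
  \<comment> \<open>an empty space carries no balls, and has no point at which a maximal function could be finite\<close>
  have no_points: "(\<lambda>x. enn2ereal (KB_maximal M \<G> f x)) \<in> BLO M \<B> \<and>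
      blo_norm M \<B> (\<lambda>x. enn2ereal (KB_maximal M \<G> f x)) \<le> b"
    if "ball_basis M \<B> hullb K" "space M = {}"
    for M :: "'a measure" and \<B> hullb \<G> f b
  proof -
    have "\<B> = {}"
      using ball_basis.ball_nonempty[OF that(1)] ball_basis.ball_in_space[OF that(1)] that(2) by blast
    then have "blo_norm M \<B> h = 0" for h by (simp add: blo_norm_def bot_ennreal)
    moreover have "AE x in M. \<bar>enn2ereal (KB_maximal M \<G> f x)\<bar> \<noteq> \<infinity>"
      by (rule AE_I2) (use that(2) in simp)
    ultimately show ?thesis by (simp add: BLO_def)
  qed
  show ?thesis
  proof (intro exI[of _ C] conjI[of "0 < C"] allI impI)
    show "0 < C" by (simp add: C_def)
    fix M :: "'a measure" and \<B> hullb \<omega> \<G>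
    assume H: "ball_basis M \<B> hullb K \<and> doubling_basis M \<B> hullb \<eta> \<and> regular_basis M \<B> hullb \<theta> \<and>
       modulus_integral \<omega> < \<infinity> \<and> KB_couple M \<B> \<omega> c\<^sub>0 c\<^sub>1 c\<^sub>2 \<eta>' \<G>"
    let ?claim = "\<lambda>f. (\<lambda>x. enn2ereal (KB_maximal M \<G> f x)) \<in> BLO M \<B> \<and>
      blo_norm M \<B> (\<lambda>x. enn2ereal (KB_maximal M \<G> f x)) \<le> ennreal C * modulus_integral \<omega> * bmo_norm M \<B> f"
    have pointed: "?claim f" if "f \<in> BMO M \<B>" "x \<in> space M" "std_maximal M \<B> f x < \<infinity>" for f x
      using bounded[OF _ _ _ _ that] H by blast
    have finite_space: "?claim f" if fX: "f \<in> BMO M \<B>" "emeasure M (space M) < \<infinity>" for f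
    proof (cases "space M = {}")
      case True
      show ?thesis by (rule no_points[OF conjunct1[OF H] True])
    next
      case False
      then obtain x where x: "x \<in> space M" by blast
      have "\<exists>y\<in>space M. std_maximal M \<B> f y < \<infinity>"
        by (rule ball_basis.std_maximal_finite_somewhere[OF _ _ fX x]) (use H in auto)
      then show ?thesis using pointed[OF fX(1)] by blast
    qed
    show "(\<forall>f \<in> BMO M \<B>. (\<exists>x\<in>space M. std_maximal M \<B> f x \<noteq> \<infinity>) \<longrightarrow> ?claim f) \<and>
       (emeasure M (space M) < \<infinity> \<longrightarrow> (\<forall>f \<in> BMO M \<B>. ?claim f))"
    proof (intro conjI[of "\<forall>f\<in>BMO M \<B>. (\<exists>x\<in>space M. std_maximal M \<B> f x \<noteq> \<infinity>) \<longrightarrow> ?claim f"] ballI impI)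
      fix f assume f: "f \<in> BMO M \<B>" and "\<exists>x\<in>space M. std_maximal M \<B> f x \<noteq> \<infinity>"
      then obtain x where "x \<in> space M" "std_maximal M \<B> f x \<noteq> \<infinity>" by blast
      then show "?claim f" using pointed[OF f, of x] by (simp only: less_top infinity_ennreal_def)
    next
      show "?claim f" if "emeasure M (space M) < \<infinity>" "f \<in> BMO M \<B>" for f
        by (rule finite_space[OF that(2,1)])
    qed
  qed
qed

end
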